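(* Let $\mathcal A$ be a small locally finite category equipped with an internally well-co-ordered generator $s\in\mathcal A$. Then the Weyl crossed $\mathcal A$-group $\mathfrak W_{\mathcal A}$ is a terminal object in the category $\mathbf{CrsGrp}_{\mathcal A}$ of crossed $\mathcal A$-groups.
   Context: **Crossed groups.** Let $\mathcal A$ be a small category. An $\mathcal A$-set is a presheaf of sets on $\mathcal A$. A crossed $\mathcal A$-group is an $\mathcal A$-set $G$ together with a group structure on $G(a)$ for each $a\in\mathcal A$ and a left action $G(b)\times\mathcal A(a,b)\to\mathcal A(a,b)$, $(x,\varphi)\mapsto\varphi^x$, of the group $G(b)$ for all $a,b\in\mathcal A$, such that: (i) for $\varphi:a\to b$, $\psi:b\to c$ and $x\in G(c)$, $(\psi\varphi)^x=\psi^x\varphi^{\psi^\ast(x)}$; (ii) for $\varphi:a\to b$ and $x,y\in G(b)$, $\varphi^\ast(xy)=(\varphi^y)^\ast(x)\varphi^\ast(y)$. Here $\varphi^\ast:G(b)\to G(a)$ is the presheaf structure map. A map of crossed $\mathcal A$-groups is a map of $\mathcal A$-sets which is degreewise a group homomorphism and respects the actions on the $\mathcal A(a,b)$. These form the category $\mathbf{CrsGrp}_{\mathcal A}$. **Setting.** $\mathcal A$ is locally finite if every hom-set $\mathcal A(a,b)$ is finite. An object $s$ is a generator if $\mathcal A(s,-):\mathcal A\to\mathbf{Set}$ is faithful. An internal co-relation on $s$ is a tuple $(\bar s;\iota_0,\iota_1)$ of an object $\bar s\in\mathcal A$ and a jointly epimorphic pair $\iota_0,\iota_1:s\rightrightarrows\bar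 s$; it induces on each set $\mathcal A(s,a)$ the binary relation: $\alpha_0\le\alpha_1$ iff there is $\bar\alpha:\bar s\to a$ with $\bar\alpha\iota_0=\alpha_0$ and $\bar\alpha\iota_1=\alpha_1$. It is an internal well-co-order if for every $a\in\mathcal A$ the set $\mathcal A(s,a)$ is well-ordered by this (reflexive) relation; then $s$ is called internally well-co-ordered. For every $\varphi:b\to a$, postcomposition $\varphi_\ast:\mathcal A(s,b)\to\mathcal A(s,a)$ is then order-preserving, and one regards $\mathcal A(b,a)$ as a subset of the set $\mathbf{Pos}(\mathcal A(s,b),\mathcal A(s,a))$ of order-preserving maps. **Permutation action.** For finite totally ordered sets $A,B$, the group $\mathfrak S(B)$ of permutations of $B$ acts from the left on the set $\mathbf{Pos}(A,B)$ of order-preserving maps: for $\sigma\in\mathfrak S(B)$ and $f\in\mathbf{Pos}(A,B)$, $f^\sigma$ is the unique order-preserving map such that $\sigma f=f^\sigma\sigma'$ for some permutation $\sigma'$ of $A$. Put $$\mathfrak S_{\mathcal A}(a)=\{\sigma\in\mathfrak S(\mathcal A(s,a))\mid \varphi^\sigma\in\mathcal A(b,a)\text{ for all }b\in\mathcal A,\ \varphi\in\mathcal A(b,a)\},$$ so $\mathfrak S_{\mathcal A}(a)$ acts on each $\mathcal A(b,a)$. **The Weyl crossed group.** Let $C_2=\{1,-1\}$. Let $\mathfrak S_{\mathcal A}(a)\ltimes C_2^{\times\mathcal A(s,a)}$ be the set $\mathfrak S_{\mathcal A}(a)\times C_2^{\times\mathcal A(s,a)}$ with multiplication $(\sigma;(\varepsilon_i)_i)(\tau;(\zeta_i)_i)=(\sigma\tau;(\varepsilon_{\tau(i)}\zeta_i)_i)$.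 Let $\varphi:b\to a$ in $\mathcal A$. For $\vec\varepsilon\in C_2^{\times\mathcal A(s,a)}$, let $\beta_\varphi(\vec\varepsilon)$ be the permutation of $\mathcal A(s,b)$ that maps each fiber $(\varphi_\ast)^{-1}\{i\}$ to itself, by the order-preserving bijection (the identity) if $\varepsilon_i=1$ and by the order-reversing bijection if $\varepsilon_i=-1$. For $\sigma\in\mathfrak S_{\mathcal A}(a)$, let $\varphi^\ast(\sigma)$ be the unique permutation of $\mathcal A(s,b)$ with $\sigma\circ\varphi_\ast=(\varphi^\sigma)_\ast\circ\varphi^\ast(\sigma)$ which restricts to an order-preserving map $(\varphi_\ast)^{-1}\{i\}\to(\varphi^\sigma_\ast)^{-1}\{\sigma(i)\}$ for each $i\in\mathcal A(s,a)$. Put $\varphi^\ast(\vec\varepsilon)=(\varepsilon_{\varphi_\ast(j)})_{j\in\mathcal A(s,b)}$. Define $$\mathfrak W_{\mathcal A}(a)=\{(\sigma;\vec\varepsilon)\in\mathfrak S_{\mathcal A}(a)\ltimes C_2^{\times\mathcal A(s,a)}\mid \forall b\in\mathcal A,\ \forall\varphi\in\mathcal A(b,a):\ \varphi^\ast(\sigma)\beta_\varphi(\vec\varepsilon)\in\mathfrak S_{\mathcal A}(b)\}.$$ This is a subgroup; with structure maps $\varphi^\ast(\sigma;\vec\varepsilon)=(\varphi^\ast(\sigma)\beta_\varphi(\vec\varepsilon);\varphi^\ast(\vec\varepsilon))$ and the action of $(\sigma;\vec\varepsilon)$ on $\mathcal A(b,a)$ by $\varphi\mapsto\varphi^\sigma$,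 $\mathfrak W_{\mathcal A}$ is a crossed $\mathcal A$-group, called the Weyl crossed $\mathcal A$-group.
   Formalization: The formal theorem adds the hypothesis that the two maps of the co-relation are distinct, ι₀ ≠ ι₁; if ι₀ = ι₁ the claim is always false (on the one-arrow category the Weyl crossed group is C₂, while the terminal crossed group is trivial). *)

theory Defs
  imports "HOL-Algebra.Group_Action"
begin

section \<open>Small categories\<close>

record ('o, 'm) category =
  Obj :: "'o set"
  Arr :: "'m set"
  Dom :: "'m \<Rightarrow> 'o"
  Cod :: "'m \<Rightarrow> 'o"
  Ident :: "'o \<Rightarrow> 'm"
  Comp :: "'m \<Rightarrow> 'm \<Rightarrow> 'm"  (infixr "\<cdot>\<index>" 70)

definition Hom :: "('o, 'm) category \<Rightarrow> 'o \<Rightarrow> 'o \<Rightarrow> 'm set" where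
  "Hom C a b = {f \<in> Arr C. Dom C f = a \<and> Cod C f = b}"

locale small_category =
  fixes C :: "('o, 'm) category" (structure)
  assumes Dom_in_Obj: "f \<in> Arr C \<Longrightarrow> Dom C f \<in> Obj C"
    and Cod_in_Obj: "f \<in> Arr C \<Longrightarrow> Cod C f \<in> Obj C"
    and Ident_in_Hom: "a \<in> Obj C \<Longrightarrow> Ident C a \<in> Hom C a a"
    and Comp_in_Hom: "\<lbrakk>f \<in> Hom C a b; g \<in> Hom C b c\<rbrakk> \<Longrightarrow> g \<cdot> f \<in> Hom C a c"
    and Comp_assoc: "\<lbrakk>f \<in> Hom C a b; g \<in> Hom C b c; h \<in> Hom C c d\<rbrakk> \<Longrightarrow> (h \<cdot> g) \<cdot> f = h \<cdot> (g \<cdot> f)"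
    and Comp_Ident_right: "f \<in> Hom C a b \<Longrightarrow> f \<cdot> Ident C a = f"
    and Comp_Ident_left: "f \<in> Hom C a b \<Longrightarrow> Ident C b \<cdot> f = f"

definition locally_finite :: "('o, 'm) category \<Rightarrow> bool" where
  "locally_finite C \<longleftrightarrow> (\<forall>a\<in>Obj C. \<forall>b\<in>Obj C. finite (Hom C a b))"

definition generator :: "('o, 'm) category \<Rightarrow> 'o \<Rightarrow> bool" where
  "generator C s \<longleftrightarrow> s \<in> Obj C \<and>
    (\<forall>a\<in>Obj C. \<forall>b\<in>Obj C. \<forall>\<phi>\<in>Hom C a b. \<forall>\<psi>\<in>Hom C a b.
       (\<forall>\<alpha>\<in>Hom C s a. \<phi> \<cdot>\<^bsub>C\<^esub> \<alpha> = \<psi> \<cdot>\<^bsub>C\<^esub> \<alpha>) \<longrightarrow> \<phi> = \<psi>)"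

section \<open>Crossed groups\<close>

text \<open>
  \<open>restr G \<phi>\<close> is the presheaf structure map of \<open>G\<close> at \<open>\<phi>\<close>, and \<open>act G x \<phi>\<close> is the arrow
  \<open>\<phi>\<close> acted on by \<open>x\<close>. The groups \<open>grp G a\<close> for different \<open>a\<close> may share elements; this is
  harmless because \<open>\<phi>\<close> determines which group \<open>x\<close> is taken from.
\<close>

record ('o, 'm, 'g) crossed_group_data =
  grp :: "'o \<Rightarrow> 'g monoid"
  restr :: "'m \<Rightarrow> 'g \<Rightarrow> 'g"
  act :: "'g \<Rightarrow> 'm \<Rightarrow> 'm"

locale crossed_group = small_category C
  for C :: "('o, 'm) category" (structure) +
  fixes G :: "('o, 'm, 'g) crossed_group_data"
  assumes grp: "a \<in> Obj C \<Longrightarrow> group (grp G a)"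
    and restr_closed: "\<lbrakk>\<phi> \<in> Hom C a b; x \<in> carrier (grp G b)\<rbrakk> \<Longrightarrow> restr G \<phi> x \<in> carrier (grp G a)"
    and restr_Ident: "\<lbrakk>a \<in> Obj C; x \<in> carrier (grp G a)\<rbrakk> \<Longrightarrow> restr G (Ident C a) x = x"
    and restr_Comp: "\<lbrakk>\<phi> \<in> Hom C a b; \<psi> \<in> Hom C b c; x \<in> carrier (grp G c)\<rbrakk>
      \<Longrightarrow> restr G (\<psi> \<cdot> \<phi>) x = restr G \<phi> (restr G \<psi> x)"
    and action: "\<lbrakk>a \<in> Obj C; b \<in> Obj C\<rbrakk>
      \<Longrightarrow> group_action (grp G b) (Hom C a b) (\<lambda>x. restrict (act G x) (Hom C a b))"
    and act_Comp: "\<lbrakk>\<phi> \<in> Hom C a b; \<psi> \<in> Hom C b c; x \<in> carrier (grp G c)\<rbrakk>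
      \<Longrightarrow> act G x (\<psi> \<cdot> \<phi>) = act G x \<psi> \<cdot> act G (restr G \<psi> x) \<phi>"
    and restr_mult: "\<lbrakk>\<phi> \<in> Hom C a b; x \<in> carrier (grp G b); y \<in> carrier (grp G b)\<rbrakk>
      \<Longrightarrow> restr G \<phi> (x \<otimes>\<^bsub>grp G b\<^esub> y)
            = restr G (act G y \<phi>) x \<otimes>\<^bsub>grp G a\<^esub> restr G \<phi> y"

text \<open>
  Maps of crossed groups are families of functions that are extensional in both arguments, so
  that equality in HOL is equality of maps. The element types of \<open>G\<close> and \<open>H\<close> may differ.
\<close>

definition crossed_group_maps ::
  "('o, 'm) category \<Rightarrow> ('o, 'm, 'g) crossed_group_data \<Rightarrow> ('o, 'm, 'h) crossed_group_data
    \<Rightarrow> ('o \<Rightarrow> 'g \<Rightarrow> 'h) set" where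
  "crossed_group_maps C G H =
    {\<theta> \<in> (\<Pi>\<^sub>E a\<in>Obj C. hom (grp G a) (grp H a) \<inter> extensional (carrier (grp G a))).
       \<forall>a\<in>Obj C. \<forall>b\<in>Obj C. \<forall>\<phi>\<in>Hom C a b. \<forall>x\<in>carrier (grp G b).
         \<theta> a (restr G \<phi> x) = restr H \<phi> (\<theta> b x) \<and> act H (\<theta> b x) \<phi> = act G x \<phi>}"

section \<open>Order-preserving maps and the permutation action\<close>

definition Pos ::
  "'a set \<Rightarrow> ('a \<Rightarrow> 'a \<Rightarrow> bool) \<Rightarrow> 'b set \<Rightarrow> ('b \<Rightarrow> 'b \<Rightarrow> bool) \<Rightarrow> ('a \<Rightarrow> 'b) set" where
  "Pos A leA B leB = {f \<in> A \<rightarrow>\<^sub>E B. monotone_on A leA leB f}"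

definition perm_act ::
  "'a set \<Rightarrow> ('a \<Rightarrow> 'a \<Rightarrow> bool) \<Rightarrow> 'b set \<Rightarrow> ('b \<Rightarrow> 'b \<Rightarrow> bool)
    \<Rightarrow> ('b \<Rightarrow> 'b) \<Rightarrow> ('a \<Rightarrow> 'b) \<Rightarrow> ('a \<Rightarrow> 'b)" where
  "perm_act A leA B leB \<sigma> f =
    (THE g. g \<in> Pos A leA B leB \<and> (\<exists>\<sigma>'\<in>Bij A. compose A \<sigma> f = compose A g \<sigma>'))"

section \<open>Internal co-relations and the Weyl crossed group\<close>

context
  fixes C :: "('o, 'm) category" (structure)
    and s :: 'o
    and sbar :: 'o and \<iota>\<^sub>0 \<iota>\<^sub>1 :: 'm
begin

definition co_relation :: bool where
  "co_relation \<longleftrightarrow> sbar \<in> Obj C \<and> \<iota>\<^sub>0 \<in> Hom C s sbar \<and> \<iota>\<^sub>1 \<in> Hom C s sbar \<and>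
    (\<forall>a\<in>Obj C. \<forall>f\<in>Hom C sbar a. \<forall>g\<in>Hom C sbar a.
       f \<cdot> \<iota>\<^sub>0 = g \<cdot> \<iota>\<^sub>0 \<and> f \<cdot> \<iota>\<^sub>1 = g \<cdot> \<iota>\<^sub>1 \<longrightarrow> f = g)"

definition le :: "'o \<Rightarrow> 'm \<Rightarrow> 'm \<Rightarrow> bool" where
  "le a \<alpha>\<^sub>0 \<alpha>\<^sub>1 \<longleftrightarrow> (\<exists>\<alpha>\<in>Hom C sbar a. \<alpha> \<cdot> \<iota>\<^sub>0 = \<alpha>\<^sub>0 \<and> \<alpha> \<cdot> \<iota>\<^sub>1 = \<alpha>\<^sub>1)"

text \<open>
  This allows \<open>\<iota>\<^sub>0 = \<iota>\<^sub>1\<close>. In that degenerate case every \<open>Hom C s a\<close> has at most one element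
  and reversing a fibre has no effect, so the Weyl crossed group is not terminal: its sign
  component at \<open>s\<close> is \<open>{1, -1}\<close>, hence its identity differs from its trivial endomorphism.
  Terminality therefore needs \<open>\<iota>\<^sub>0 \<noteq> \<iota>\<^sub>1\<close> as a separate hypothesis.
\<close>

definition well_co_order :: bool where
  "well_co_order \<longleftrightarrow> co_relation \<and>
    (\<forall>a\<in>Obj C. well_order_on (Hom C s a)
       {(\<alpha>\<^sub>0, \<alpha>\<^sub>1). \<alpha>\<^sub>0 \<in> Hom C s a \<and> \<alpha>\<^sub>1 \<in> Hom C s a \<and> le a \<alpha>\<^sub>0 \<alpha>\<^sub>1})"

definition push :: "'m \<Rightarrow> 'm \<Rightarrow> 'm" where
  "push \<phi> = (\<lambda>\<alpha>\<in>Hom C s (Dom C \<phi>). \<phi> \<cdot> \<alpha>)"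

definition push_act :: "('m \<Rightarrow> 'm) \<Rightarrow> 'm \<Rightarrow> 'm \<Rightarrow> 'm" where
  "push_act \<sigma> \<phi> =
    perm_act (Hom C s (Dom C \<phi>)) (le (Dom C \<phi>)) (Hom C s (Cod C \<phi>)) (le (Cod C \<phi>)) \<sigma> (push \<phi>)"

definition sym_perms :: "'o \<Rightarrow> ('m \<Rightarrow> 'm) set" where
  "sym_perms a =
    {\<sigma> \<in> Bij (Hom C s a). \<forall>b\<in>Obj C. \<forall>\<phi>\<in>Hom C b a. push_act \<sigma> \<phi> \<in> push ` Hom C b a}"

text \<open>The arrow that corresponds to \<open>push_act \<sigma> \<phi>\<close> when \<open>\<sigma> \<in> sym_perms (Cod C \<phi>)\<close>; it is
  unique if \<open>s\<close> is a generator.\<close>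

definition sym_act :: "('m \<Rightarrow> 'm) \<Rightarrow> 'm \<Rightarrow> 'm" where
  "sym_act \<sigma> \<phi> = (THE \<psi>. \<psi> \<in> Hom C (Dom C \<phi>) (Cod C \<phi>) \<and> push \<psi> = push_act \<sigma> \<phi>)"

definition fiber :: "'m \<Rightarrow> 'm \<Rightarrow> 'm set" where
  "fiber \<phi> i = {\<alpha> \<in> Hom C s (Dom C \<phi>). push \<phi> \<alpha> = i}"

text \<open>The permutation \<open>\<beta>\<^sub>\<phi>(\<epsilon>)\<close>; signs are the integers \<open>1\<close> and \<open>-1\<close>.\<close>

definition flip_fibers :: "'m \<Rightarrow> ('m \<Rightarrow> int) \<Rightarrow> 'm \<Rightarrow> 'm" where
  "flip_fibers \<phi> \<epsilon> =
    (THE \<pi>. \<pi> \<in> Bij (Hom C s (Dom C \<phi>)) \<and>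
       (\<forall>i\<in>Hom C s (Cod C \<phi>). bij_betw \<pi> (fiber \<phi> i) (fiber \<phi> i) \<and>
          (if \<epsilon> i = 1
           then monotone_on (fiber \<phi> i) (le (Dom C \<phi>)) (le (Dom C \<phi>)) \<pi>
           else monotone_on (fiber \<phi> i) (le (Dom C \<phi>)) (\<lambda>\<alpha> \<alpha>'. le (Dom C \<phi>) \<alpha>' \<alpha>) \<pi>)))"

text \<open>The permutation \<open>\<phi>\<^sup>*(\<sigma>)\<close>.\<close>

definition pull_perm :: "'m \<Rightarrow> ('m \<Rightarrow> 'm) \<Rightarrow> 'm \<Rightarrow> 'm" where
  "pull_perm \<phi> \<sigma> =
    (THE \<pi>. \<pi> \<in> Bij (Hom C s (Dom C \<phi>)) \<and>
       compose (Hom C s (Dom C \<phi>)) \<sigma> (push \<phi>)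
         = compose (Hom C s (Dom C \<phi>)) (push (sym_act \<sigma> \<phi>)) \<pi> \<and>
       (\<forall>i\<in>Hom C s (Cod C \<phi>).
          \<pi> \<in> fiber \<phi> i \<rightarrow> fiber (sym_act \<sigma> \<phi>) (\<sigma> i) \<and>
          monotone_on (fiber \<phi> i) (le (Dom C \<phi>)) (le (Dom C \<phi>)) \<pi>))"

definition pull_signs :: "'m \<Rightarrow> ('m \<Rightarrow> int) \<Rightarrow> 'm \<Rightarrow> int" where
  "pull_signs \<phi> \<epsilon> = (\<lambda>j\<in>Hom C s (Dom C \<phi>). \<epsilon> (push \<phi> j))"

definition signed_perms :: "'o \<Rightarrow> (('m \<Rightarrow> 'm) \<times> ('m \<Rightarrow> int)) monoid" where
  "signed_perms a =
    \<lparr>carrier = sym_perms a \<times> (Hom C s a \<rightarrow>\<^sub>E {1, -1}),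
     monoid.mult = (\<lambda>(\<sigma>, \<epsilon>) (\<tau>, \<zeta>). (compose (Hom C s a) \<sigma> \<tau>, \<lambda>i\<in>Hom C s a. \<epsilon> (\<tau> i) * \<zeta> i)),
     one = (\<lambda>i\<in>Hom C s a. i, \<lambda>i\<in>Hom C s a. 1)\<rparr>"

definition weyl_perm :: "'m \<Rightarrow> ('m \<Rightarrow> 'm) \<times> ('m \<Rightarrow> int) \<Rightarrow> 'm \<Rightarrow> 'm" where
  "weyl_perm \<phi> = (\<lambda>(\<sigma>, \<epsilon>). compose (Hom C s (Dom C \<phi>)) (pull_perm \<phi> \<sigma>) (flip_fibers \<phi> \<epsilon>))"

definition weyl_elements :: "'o \<Rightarrow> (('m \<Rightarrow> 'm) \<times> ('m \<Rightarrow> int)) set" where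
  "weyl_elements a =
    {w \<in> carrier (signed_perms a). \<forall>b\<in>Obj C. \<forall>\<phi>\<in>Hom C b a. weyl_perm \<phi> w \<in> sym_perms b}"

definition weyl :: "('o, 'm, ('m \<Rightarrow> 'm) \<times> ('m \<Rightarrow> int)) crossed_group_data" where
  "weyl =
    \<lparr>grp = (\<lambda>a. (signed_perms a)\<lparr>carrier := weyl_elements a\<rparr>),
     restr = (\<lambda>\<phi> w. (weyl_perm \<phi> w, pull_signs \<phi> (snd w))),
     act = (\<lambda>w \<phi>. sym_act (fst w) \<phi>)\<rparr>"

end

end

theory Submission
  imports Defs
begin

text \<open>
  For an element \<open>(\<sigma>; \<epsilon>)\<close> and an arrow \<open>\<phi>\<close> there are a unique arrow \<open>\<psi> = \<phi>\<^sup>\<sigma>\<close> and a unique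
  permutation \<open>\<pi> = \<phi>\<^sup>*(\<sigma>) \<beta>\<^sub>\<phi>(\<epsilon>)\<close> with \<open>\<sigma> \<phi> = \<psi> \<pi>\<close> such that \<open>\<pi>\<close> is monotone or antitone on
  the fibre over \<open>i\<close> according to the sign \<open>\<epsilon>\<^sub>i\<close>. Such squares can be pasted, and by uniqueness
  the crossed group axioms of the Weyl crossed group are pasting laws.

  In a crossed group \<open>G\<close>, an element \<open>x \<in> G(a)\<close> permutes \<open>A(s, a)\<close>, and by axiom (i) the elements
  \<open>x\<close> and \<open>\<phi>\<^sup>*(x)\<close> form such a square with \<open>\<psi> = \<phi>\<^sup>x\<close>. Two elements \<open>\<alpha> \<le> \<beta>\<close> of the fibre of \<open>\<phi>\<close>
  over \<open>i\<close> come from one arrow \<open>f\<close> out of \<open>sbar\<close>, and \<open>\<phi> f\<close> is the degenerate arrow \<open>d\<close> with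
  \<open>d \<iota>\<^sub>0 = i = d \<iota>\<^sub>1\<close>. Hence whether \<open>\<phi>\<^sup>*(x)\<close> keeps or reverses their order depends only on how
  \<open>d\<^sup>*(x)\<close> acts on the pair \<open>\<iota>\<^sub>0 < \<iota>\<^sub>1\<close>, which determines the sign \<open>\<epsilon>\<^sub>i\<close>.

  For uniqueness, a map to the Weyl crossed group only fixes \<open>\<phi>\<^sup>\<sigma>\<close> for \<open>\<phi> : s \<rightarrow> a\<close>, and one needs
  \<open>\<phi>\<^sup>\<sigma> = \<sigma>(\<phi>)\<close>. This is not immediate since \<open>s\<close> may have endomorphisms \<open>m\<close> other than the
  identity; but precomposition with such an \<open>m\<close> is constant on every \<open>A(s, a)\<close>, with value the
  least or the greatest element.
\<close>

section \<open>Permutations and finite chains\<close>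

lemma Bij_apply: "\<lbrakk>\<pi> \<in> Bij S; x \<in> S\<rbrakk> \<Longrightarrow> \<pi> x \<in> S"
  by (auto simp: Bij_def bij_betw_apply)

lemma Bij_eqD: "\<lbrakk>\<pi> \<in> Bij S; x \<in> S; y \<in> S; \<pi> x = \<pi> y\<rbrakk> \<Longrightarrow> x = y"
  by (auto simp: Bij_def bij_betw_def dest: inj_onD)

lemma Bij_inverseE:
  assumes "\<pi> \<in> Bij S"
  obtains \<rho> where "\<rho> \<in> Bij S" "\<And>x. x \<in> S \<Longrightarrow> \<rho> (\<pi> x) = x" "\<And>x. x \<in> S \<Longrightarrow> \<pi> (\<rho> x) = x"
proof (rule that)
  show "restrict (inv_into S \<pi>) S \<in> Bij S" using assms by (rule restrict_inv_into_Bij)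
qed (use assms in \<open>auto simp: Bij_def bij_betw_apply bij_betw_inv_into_left bij_betw_inv_into_right\<close>)

lemma Bij_eqI: "\<lbrakk>\<pi> \<in> Bij S; \<rho> \<in> Bij S; \<And>x. x \<in> S \<Longrightarrow> \<pi> x = \<rho> x\<rbrakk> \<Longrightarrow> \<pi> = \<rho>"
  by (meson Bij_imp_extensional extensionalityI)

lemma PiE_image: "f \<in> A \<rightarrow>\<^sub>E B \<Longrightarrow> f ` A \<subseteq> B"
  by auto

text \<open>The order is a predicate relativised to a carrier, since the chains are hom-sets and one
  carrier will be given several orders.\<close>

locale finite_chain =
  fixes A :: "'a set" and leA :: "'a \<Rightarrow> 'a \<Rightarrow> bool"
  assumes finite: "finite A"
    and refl: "x \<in> A \<Longrightarrow> leA x x"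
    and trans: "\<lbrakk>x \<in> A; y \<in> A; z \<in> A; leA x y; leA y z\<rbrakk> \<Longrightarrow> leA x z"
    and antisym: "\<lbrakk>x \<in> A; y \<in> A; leA x y; leA y x\<rbrakk> \<Longrightarrow> x = y"
    and total: "\<lbrakk>x \<in> A; y \<in> A\<rbrakk> \<Longrightarrow> leA x y \<or> leA y x"
begin

text \<open>Finiteness upgrades the linear order to a well-order; written as a relation it can be
  compared with others by ordinal isomorphism.\<close>

lemma well_order: "well_order_on A {(x, y). x \<in> A \<and> y \<in> A \<and> leA x y}"
proof (rule linear_order_on_well_order_on[THEN iffD1])
  show "Finite_Set.finite {(x, y). x \<in> A \<and> y \<in> A \<and> leA x y}"
    by (rule finite_subset[of _ "A \<times> A"]) (auto simp: finite)
  let ?r = "{(x, y). x \<in> A \<and> y \<in> A \<and> leA x y}"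
  have "refl_on A ?r" using refl by (simp add: refl_on_def)
  moreover have "Relation.trans ?r" by (rule transI) (use trans in blast)
  moreover have "Relation.antisym ?r" by (rule antisymI) (use antisym in blast)
  moreover have "total_on A ?r" by (rule total_onI) (use total in blast)
  ultimately show "linear_order_on A ?r" by (auto simp: order_on_defs)
qed

end

lemma finite_chainI_well_order:
  assumes "finite A" "well_order_on A {(x, y). x \<in> A \<and> y \<in> A \<and> leA x y}"
  shows "finite_chain A leA"
proof
  let ?r = "{(x, y). x \<in> A \<and> y \<in> A \<and> leA x y}"
  have r: "refl_on A ?r" "trans ?r" "antisym ?r" "total_on A ?r"
    using assms(2) by (auto simp: order_on_defs)
  show "finite A" by fact
  show "\<And>x. x \<in> A \<Longrightarrow> leA x x" using r(1) by (auto simp: refl_on_def)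
  show "\<And>x y z. \<lbrakk>x \<in> A; y \<in> A; z \<in> A; leA x y; leA y z\<rbrakk> \<Longrightarrow> leA x z"
    using transD[OF r(2)] by blast
  show "\<And>x y. \<lbrakk>x \<in> A; y \<in> A; leA x y; leA y x\<rbrakk> \<Longrightarrow> x = y"
    using antisymD[OF r(3)] by blast
  show "\<And>x y. \<lbrakk>x \<in> A; y \<in> A\<rbrakk> \<Longrightarrow> leA x y \<or> leA y x"
    using r(1,4) unfolding total_on_def refl_on_def mem_Collect_eq case_prod_conv by metis
qed

text \<open>Well-orders of one finite set all have the same order type.\<close>

lemma finite_chains_isomorphic:
  assumes "finite_chain A leA" "finite_chain A leA'"
  obtains \<pi> where "bij_betw \<pi> A A" "\<And>x y. \<lbrakk>x \<in> A; y \<in> A\<rbrakk> \<Longrightarrow> leA x y \<longleftrightarrow> leA' (\<pi> x) (\<pi> y)"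
proof -
  let ?r = "\<lambda>leA. {(x, y). x \<in> A \<and> y \<in> A \<and> leA x y}"
  have wo: "well_order_on A (?r leA)" "well_order_on A (?r leA')"
    using assms finite_chain.well_order by auto
  have field: "Field (?r leA) = A" "Field (?r leA') = A"
    using wo well_order_on_Field by blast+
  obtain \<pi> where "BNF_Wellorder_Embedding.iso (?r leA) (?r leA') \<pi>"
    using finite_well_order_on_ordIso[OF finite_chain.finite[OF assms(1)] wo] 
    unfolding ordIso_def by blast
  then have "bij_betw \<pi> A A" "\<forall>x\<in>A. \<forall>y\<in>A. (x, y) \<in> ?r leA \<longleftrightarrow> (\<pi> x, \<pi> y) \<in> ?r leA'"
    unfolding iso_iff2 field by auto
  with that show thesis by (auto simp: bij_betw_apply)
qed

text \<open>Comparing the sizes of the initial segments \<open>{x. g x \<le> g a}\<close> and \<open>{x. g' x \<le> g a}\<close>.\<close>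

lemma monotone_rearrangement_not_less:
  assumes "finite_chain A leA" "finite_chain B leB"
    and g: "g \<in> A \<rightarrow> B" "monotone_on A leA leB g"
    and g': "g' \<in> A \<rightarrow> B" "monotone_on A leA leB g'"
    and \<pi>: "bij_betw \<pi> A A" "\<And>x. x \<in> A \<Longrightarrow> g x = g' (\<pi> x)"
    and a: "a \<in> A" "leB (g a) (g' a)"
  shows "g a = g' a"
proof (rule ccontr)
  interpret A: finite_chain A leA by fact
  interpret B: finite_chain B leB by fact
  assume ne: "g a \<noteq> g' a"
  let ?L = "\<lambda>h. {x \<in> A. leB (h x) (g a)}"
  \<comment> \<open>The permutation carries one segment onto the other, so they have equally many
    elements.\<close>
  have img: "\<pi> ` ?L g = ?L g'"
  proof (intro equalityI subsetI)
    fix y assume y: "y \<in> ?L g'"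
    then obtain x where "x \<in> A" "y = \<pi> x"
      using \<pi>(1) unfolding bij_betw_def by blast
    with y \<pi>(2)[of x] show "y \<in> \<pi> ` ?L g" by auto
  next
    fix y assume "y \<in> \<pi> ` ?L g"
    then obtain x where "x \<in> A" "leB (g x) (g a)" "y = \<pi> x" by blast
    with \<pi>(2)[of x] bij_betw_apply[OF \<pi>(1)] show "y \<in> ?L g'" by simp
  qed
  have inj: "inj_on \<pi> (?L g)"
    using \<pi>(1) by (rule inj_on_subset[OF bij_betw_imp_inj_on]) simp
  have card: "card (?L g) = card (?L g')"
    using card_image[OF inj] unfolding img by (rule sym)
  have B: "g x \<in> B" "g' x \<in> B" if "x \<in> A" for x using g(1) g'(1) that by auto
  \<comment> \<open>Anything above \<open>a\<close> has \<open>g'\<close>-value at least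
    \<open>g' a\<close>, which is strictly above \<open>g a\<close>; so the second segment lies
    below \<open>a\<close>, where \<open>g\<close> stays below \<open>g a\<close>. The element
    \<open>a\<close> belongs to the first segment only.\<close>
  have "?L g' \<subset> ?L g"
  proof
    show "?L g' \<subseteq> ?L g"
    proof
      fix x assume "x \<in> ?L g'"
      then have x: "x \<in> A" "leB (g' x) (g a)" by auto
      have "leA x a"
      proof (rule ccontr)
        assume "\<not> leA x a"
        with x a A.total have "leA a x" by blast
        then have "leB (g' a) (g' x)" using monotone_onD[OF g'(2)] a x by blast
        then have "leB (g' a) (g a)"
          using B.trans[OF B(2)[OF a(1)] B(2)[OF x(1)] B(1)[OF a(1)]] x by blast
        with a ne B.antisym[OF B[OF a(1)]] show False by blast
      qed
      then have "leB (g x) (g a)" using monotone_onD[OF g(2)] a x by blast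
      with x show "x \<in> ?L g" by simp
    qed
    have "a \<in> ?L g" using a B B.refl by simp
    moreover have "a \<notin> ?L g'"
      using a ne B.antisym[OF B[OF a(1)]] by auto
    ultimately show "?L g' \<noteq> ?L g" by blast
  qed
  then have "card (?L g') < card (?L g)"
    by (intro psubset_card_mono) (simp_all add: A.finite)
  with card show False by simp
qed

text \<open>By totality one of \<open>g a\<close>, \<open>g' a\<close> is the smaller; inverting
  \<open>\<pi>\<close> exchanges the roles of \<open>g\<close> and \<open>g'\<close>, so the
  preceding lemma covers both cases.\<close>

lemma monotone_rearrangement_unique:
  assumes "finite_chain A leA" "finite_chain B leB"
    and g: "g \<in> A \<rightarrow> B" "monotone_on A leA leB g"
    and g': "g' \<in> A \<rightarrow> B" "monotone_on A leA leB g'"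
    and \<pi>: "bij_betw \<pi> A A" "\<And>x. x \<in> A \<Longrightarrow> g x = g' (\<pi> x)"
    and a: "a \<in> A"
  shows "g a = g' a"
proof -
  interpret B: finite_chain B leB by fact
  have inv: "g' x = g (inv_into A \<pi> x)" if "x \<in> A" for x
    using \<pi>(2)[of "inv_into A \<pi> x"] bij_betw_inv_into_right[OF \<pi>(1) that]
      bij_betw_apply[OF bij_betw_inv_into[OF \<pi>(1)] that] by simp
  have "leB (g a) (g' a) \<or> leB (g' a) (g a)"
    using B.total[of "g a" "g' a"] funcset_mem[OF g(1) a] funcset_mem[OF g'(1) a] by blast
  then show ?thesis
    using monotone_rearrangement_not_less[OF assms(1,2) g g' \<pi> a]
      monotone_rearrangement_not_less[OF assms(1,2) g' g bij_betw_inv_into[OF \<pi>(1)] inv a]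
    by metis
qed

text \<open>Sort \<open>A\<close> by the value of \<open>h\<close> and break ties by \<open>leA\<close> or its converse, according to \<open>e\<close>.\<close>

lemma monotone_rearrangement_exists:
  assumes "finite_chain A leA" "finite_chain B leB" and h: "h \<in> A \<rightarrow> B"
  obtains \<pi> g where "bij_betw \<pi> A A" "g \<in> A \<rightarrow> B" "monotone_on A leA leB g"
    "\<And>x. x \<in> A \<Longrightarrow> h x = g (\<pi> x)"
    "\<And>x y. \<lbrakk>x \<in> A; y \<in> A; h x = h y; leA x y\<rbrakk>
      \<Longrightarrow> if e (h x) then leA (\<pi> x) (\<pi> y) else leA (\<pi> y) (\<pi> x)"
proof -
  interpret A: finite_chain A leA by fact
  interpret B: finite_chain B leB by fact
  define lt where "lt x y \<longleftrightarrow> leB (h x) (h y) \<and>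
    (h x = h y \<longrightarrow> (if e (h x) then leA x y else leA y x))" for x y
  have hB: "h x \<in> B" if "x \<in> A" for x using h that by auto
  have "finite_chain A lt"
  proof
    show "finite A" by (rule A.finite)
    show "lt x x" if "x \<in> A" for x
      using that hB A.refl B.refl by (auto simp: lt_def)
    show "lt x z" if x: "x \<in> A" and y: "y \<in> A" and z: "z \<in> A" and "lt x y" "lt y z" for x y z
    proof -
      have le: "leB (h x) (h y)" "leB (h y) (h z)"
        and xy: "h x = h y \<Longrightarrow> if e (h x) then leA x y else leA y x"
        and yz: "h y = h z \<Longrightarrow> if e (h y) then leA y z else leA z y"
        using \<open>lt x y\<close> \<open>lt y z\<close> by (auto simp: lt_def)
      have "leB (h x) (h z)" using B.trans[OF hB[OF x] hB[OF y] hB[OF z] le] .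
      moreover have "if e (h x) then leA x z else leA z x" if eq: "h x = h z"
      proof -
        have "h x = h y" using B.antisym[OF hB[OF x] hB[OF y] le(1)] le(2) eq by simp
        with xy yz eq show ?thesis
          using A.trans[OF x y z] A.trans[OF z y x] by (cases "e (h x)") simp_all
      qed
      ultimately show ?thesis by (simp add: lt_def)
    qed
    show "x = y" if x: "x \<in> A" and y: "y \<in> A" and "lt x y" "lt y x" for x y
    proof -
      have "h x = h y"
        using B.antisym[OF hB[OF x] hB[OF y]] \<open>lt x y\<close> \<open>lt y x\<close> by (simp add: lt_def)
      with \<open>lt x y\<close> \<open>lt y x\<close> show ?thesis
        using A.antisym[OF x y] by (cases "e (h x)") (simp_all add: lt_def)
    qed
    show "lt x y \<or> lt y x" if x: "x \<in> A" and y: "y \<in> A" for x y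
    proof (cases "h x = h y")
      case True
      then show ?thesis
        using A.total[OF x y] B.refl[OF hB[OF y]] by (cases "e (h x)") (auto simp: lt_def)
    next
      case False
      then show ?thesis using B.total[OF hB[OF x] hB[OF y]] by (auto simp: lt_def)
    qed
  qed
  \<comment> \<open>\<open>\<pi>\<close> sends an element to the one that holds its
    \<open>lt\<close>-rank in the order \<open>leA\<close>; \<open>g\<close> then lists the values
    of \<open>h\<close> in increasing order.\<close>
  then obtain \<pi> where \<pi>: "bij_betw \<pi> A A"
    and iso: "\<And>x y. \<lbrakk>x \<in> A; y \<in> A\<rbrakk> \<Longrightarrow> lt x y \<longleftrightarrow> leA (\<pi> x) (\<pi> y)"
    using finite_chains_isomorphic[OF _ assms(1)] by blast
  have inv: "inv_into A \<pi> x \<in> A" "\<pi> (inv_into A \<pi> x) = x" if "x \<in> A" for x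
    using \<pi> that by (auto simp: bij_betw_def inv_into_into f_inv_into_f)
  have inv': "inv_into A \<pi> (\<pi> x) = x" if "x \<in> A" for x
    using \<pi> that by (simp add: bij_betw_inv_into_left)
  define g where "g x = h (inv_into A \<pi> x)" for x
  show thesis
  proof (rule that)
    show "bij_betw \<pi> A A" by fact
    show "g \<in> A \<rightarrow> B" using inv(1) hB by (auto simp: g_def)
    show "monotone_on A leA leB g"
    proof (rule monotone_onI)
      fix x y assume "x \<in> A" "y \<in> A" "leA x y"
      then have "lt (inv_into A \<pi> x) (inv_into A \<pi> y)"
        using iso inv by auto
      then show "leB (g x) (g y)" by (simp add: g_def lt_def)
    qed
    show "h x = g (\<pi> x)" if "x \<in> A" for x
      using inv' that by (simp add: g_def)
    show "if e (h x) then leA (\<pi> x) (\<pi> y) else leA (\<pi> y) (\<pi> x)"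
      if "x \<in> A" "y \<in> A" "h x = h y" "leA x y" for x y
    proof (cases "e (h x)")
      case True
      then have "lt x y" using that hB B.refl by (simp add: lt_def)
      with True that iso show ?thesis by simp
    next
      case False
      then have "lt y x" using that hB B.refl by (simp add: lt_def)
      with False that iso show ?thesis by simp
    qed
  qed
qed

section \<open>Twisted naturality squares\<close>

text \<open>The hypothesis \<open>neq\<close> enters in \<open>sign_eq_1_iff\<close>, where a sign
  is recovered from the order of two distinct points.\<close>

locale co_ordered_category = small_category C
  for C :: "('o, 'm) category" (structure) +
  fixes s sbar :: 'o and \<iota>\<^sub>0 \<iota>\<^sub>1 :: 'm
  assumes locally_finite: "locally_finite C"
    and generator: "generator C s"
    and well_co_order: "well_co_order C s sbar \<iota>\<^sub>0 \<iota>\<^sub>1"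
    and neq: "\<iota>\<^sub>0 \<noteq> \<iota>\<^sub>1"
begin

abbreviation P :: "'o \<Rightarrow> 'm set" where "P \<equiv> Hom C s"
abbreviation lea :: "'o \<Rightarrow> 'm \<Rightarrow> 'm \<Rightarrow> bool" where "lea \<equiv> le C sbar \<iota>\<^sub>0 \<iota>\<^sub>1"
abbreviation syms :: "'o \<Rightarrow> ('m \<Rightarrow> 'm) set" where "syms \<equiv> sym_perms C s sbar \<iota>\<^sub>0 \<iota>\<^sub>1"
abbreviation pact :: "('m \<Rightarrow> 'm) \<Rightarrow> 'm \<Rightarrow> 'm \<Rightarrow> 'm" where "pact \<equiv> push_act C s sbar \<iota>\<^sub>0 \<iota>\<^sub>1"
abbreviation sact :: "('m \<Rightarrow> 'm) \<Rightarrow> 'm \<Rightarrow> 'm" where "sact \<equiv> sym_act C s sbar \<iota>\<^sub>0 \<iota>\<^sub>1"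
abbreviation wperm where "wperm \<equiv> weyl_perm C s sbar \<iota>\<^sub>0 \<iota>\<^sub>1"
abbreviation W where "W \<equiv> weyl C s sbar \<iota>\<^sub>0 \<iota>\<^sub>1"
abbreviation Wel where "Wel \<equiv> weyl_elements C s sbar \<iota>\<^sub>0 \<iota>\<^sub>1"

section \<open>Arrows out of the generator as finite chains\<close>

lemma Hom_D: "\<phi> \<in> Hom C b a \<Longrightarrow> Dom C \<phi> = b \<and> Cod C \<phi> = a"
  by (simp add: Hom_def)

lemma Hom_Obj: assumes "\<phi> \<in> Hom C b a" shows "b \<in> Obj C" "a \<in> Obj C"
  using assms Dom_in_Obj Cod_in_Obj by (auto simp: Hom_def)

lemma s_Obj: "s \<in> Obj C"
  using generator by (simp add: generator_def)

lemma co_relation: "co_relation C s sbar \<iota>\<^sub>0 \<iota>\<^sub>1"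
  using well_co_order by (simp add: well_co_order_def)

lemma sbar_Obj: "sbar \<in> Obj C" and \<iota>_Hom: "\<iota>\<^sub>0 \<in> P sbar" "\<iota>\<^sub>1 \<in> P sbar"
  using co_relation by (auto simp: co_relation_def)

lemma jointly_epi:
  assumes "f \<in> Hom C sbar a" "g \<in> Hom C sbar a" "f \<cdot> \<iota>\<^sub>0 = g \<cdot> \<iota>\<^sub>0" "f \<cdot> \<iota>\<^sub>1 = g \<cdot> \<iota>\<^sub>1"
  shows "f = g"
  using co_relation assms Hom_Obj(2)[OF assms(1)] by (auto simp: co_relation_def)

lemma finite_Hom: "finite (Hom C b a)"
proof (cases "Hom C b a = {}")
  case False
  then show ?thesis using Hom_Obj locally_finite by (auto simp: locally_finite_def)
qed simp

lemma chain: "a \<in> Obj C \<Longrightarrow> finite_chain (P a) (lea a)"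
  using well_co_order finite_Hom by (auto simp: well_co_order_def intro: finite_chainI_well_order)

lemma comp_P: "\<lbrakk>\<phi> \<in> Hom C b a; \<alpha> \<in> P b\<rbrakk> \<Longrightarrow> \<phi> \<cdot> \<alpha> \<in> P a"
  by (rule Comp_in_Hom)

text \<open>The arrow out of \<open>sbar\<close> that witnesses the comparison is composed with
  \<open>\<phi>\<close>.\<close>

lemma comp_monotone:
  assumes "\<phi> \<in> Hom C b a" "lea b \<alpha> \<beta>"
  shows "lea a (\<phi> \<cdot> \<alpha>) (\<phi> \<cdot> \<beta>)"
proof -
  obtain f where "f \<in> Hom C sbar b" "f \<cdot> \<iota>\<^sub>0 = \<alpha>" "f \<cdot> \<iota>\<^sub>1 = \<beta>"
    using assms(2) by (auto simp: le_def)
  with assms(1) \<iota>_Hom have "\<phi> \<cdot> f \<in> Hom C sbar a" "(\<phi> \<cdot> f) \<cdot> \<iota>\<^sub>0 = \<phi> \<cdot> \<alpha>" "(\<phi> \<cdot> f) \<cdot> \<iota>\<^sub>1 = \<phi> \<cdot> \<beta>"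
    by (auto simp: Comp_assoc intro: Comp_in_Hom)
  then show ?thesis by (auto simp: le_def)
qed

lemma le_refl: "\<alpha> \<in> P a \<Longrightarrow> lea a \<alpha> \<alpha>"
  using finite_chain.refl[OF chain] Hom_Obj(2) by metis
lemma le_antisym: "\<lbrakk>\<alpha> \<in> P a; \<beta> \<in> P a; lea a \<alpha> \<beta>; lea a \<beta> \<alpha>\<rbrakk> \<Longrightarrow> \<alpha> = \<beta>"
  using finite_chain.antisym[OF chain] Hom_Obj(2) by metis
lemma le_total: "\<lbrakk>\<alpha> \<in> P a; \<beta> \<in> P a\<rbrakk> \<Longrightarrow> lea a \<alpha> \<beta> \<or> lea a \<beta> \<alpha>"
  using finite_chain.total[OF chain] Hom_Obj(2) by metis

lemma faithful:
  assumes "\<phi> \<in> Hom C b a" "\<psi> \<in> Hom C b a" "\<And>\<alpha>. \<alpha> \<in> P b \<Longrightarrow> \<phi> \<cdot> \<alpha> = \<psi> \<cdot> \<alpha>"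
  shows "\<phi> = \<psi>"
  using generator assms Hom_Obj[OF assms(1)] by (auto simp: generator_def)

lemma push_apply: "\<lbrakk>\<phi> \<in> Hom C b a; \<alpha> \<in> P b\<rbrakk> \<Longrightarrow> push C s \<phi> \<alpha> = \<phi> \<cdot> \<alpha>"
  by (simp add: push_def Hom_D)

lemma push_Pos: "\<phi> \<in> Hom C b a \<Longrightarrow> push C s \<phi> \<in> Pos (P b) (lea b) (P a) (lea a)"
  by (auto simp: Pos_def push_def Hom_D comp_P monotone_on_def comp_monotone)

lemma push_inj: "\<lbrakk>\<phi> \<in> Hom C b a; \<psi> \<in> Hom C b a; push C s \<phi> = push C s \<psi>\<rbrakk> \<Longrightarrow> \<phi> = \<psi>"
  by (metis faithful push_apply)

text \<open>
  \<open>twists \<phi> \<psi> \<sigma> \<epsilon> \<pi> b a\<close> says that \<open>\<psi> = \<phi>\<^sup>\<sigma>\<close> and that \<open>\<pi>\<close> is the permutation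
  \<open>\<phi>\<^sup>*(\<sigma>) \<beta>\<^sub>\<phi>(\<epsilon>)\<close>; see \<open>sym_act_eq\<close> and \<open>weyl_perm_eq\<close>. The relation composes both
  vertically (group multiplication) and horizontally (composition of arrows).
\<close>

definition twists :: "'m \<Rightarrow> 'm \<Rightarrow> ('m \<Rightarrow> 'm) \<Rightarrow> ('m \<Rightarrow> int) \<Rightarrow> ('m \<Rightarrow> 'm) \<Rightarrow> 'o \<Rightarrow> 'o \<Rightarrow> bool" where
  "twists \<phi> \<psi> \<sigma> \<epsilon> \<pi> b a \<longleftrightarrow> \<phi> \<in> Hom C b a \<and> \<psi> \<in> Hom C b a \<and> \<pi> \<in> Bij (P b) \<and>
     (\<forall>\<alpha>\<in>P b. \<sigma> (\<phi> \<cdot> \<alpha>) = \<psi> \<cdot> \<pi> \<alpha>) \<and>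
     (\<forall>\<alpha>\<in>P b. \<forall>\<beta>\<in>P b. \<phi> \<cdot> \<alpha> = \<phi> \<cdot> \<beta> \<longrightarrow> lea b \<alpha> \<beta> \<longrightarrow>
        (if \<epsilon> (\<phi> \<cdot> \<alpha>) = 1 then lea b (\<pi> \<alpha>) (\<pi> \<beta>) else lea b (\<pi> \<beta>) (\<pi> \<alpha>)))"

text \<open>The sign may be read at \<open>\<phi> \<cdot> \<beta>\<close> instead of
  \<open>\<phi> \<cdot> \<alpha>\<close>, the two points being in one fibre. Every value other than
  \<open>1\<close> counts as a reversal.\<close>

lemma twistsI:
  assumes "\<phi> \<in> Hom C b a" "\<psi> \<in> Hom C b a" "\<pi> \<in> Bij (P b)"
    "\<And>\<alpha>. \<alpha> \<in> P b \<Longrightarrow> \<sigma> (\<phi> \<cdot> \<alpha>) = \<psi> \<cdot> \<pi> \<alpha>"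
    "\<And>\<alpha> \<beta>. \<lbrakk>\<alpha> \<in> P b; \<beta> \<in> P b; \<phi> \<cdot> \<alpha> = \<phi> \<cdot> \<beta>; lea b \<alpha> \<beta>; \<epsilon> (\<phi> \<cdot> \<beta>) = 1\<rbrakk> \<Longrightarrow> lea b (\<pi> \<alpha>) (\<pi> \<beta>)"
    "\<And>\<alpha> \<beta>. \<lbrakk>\<alpha> \<in> P b; \<beta> \<in> P b; \<phi> \<cdot> \<alpha> = \<phi> \<cdot> \<beta>; lea b \<alpha> \<beta>; \<epsilon> (\<phi> \<cdot> \<beta>) \<noteq> 1\<rbrakk> \<Longrightarrow> lea b (\<pi> \<beta>) (\<pi> \<alpha>)"
  shows "twists \<phi> \<psi> \<sigma> \<epsilon> \<pi> b a"
  using assms by (auto simp: twists_def)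

lemma twistsD:
  assumes "twists \<phi> \<psi> \<sigma> \<epsilon> \<pi> b a"
  shows "\<phi> \<in> Hom C b a" "\<psi> \<in> Hom C b a" "\<pi> \<in> Bij (P b)"
    "\<And>\<alpha>. \<alpha> \<in> P b \<Longrightarrow> \<sigma> (\<phi> \<cdot> \<alpha>) = \<psi> \<cdot> \<pi> \<alpha>"
    "\<And>\<alpha> \<beta>. \<lbrakk>\<alpha> \<in> P b; \<beta> \<in> P b; \<phi> \<cdot> \<alpha> = \<phi> \<cdot> \<beta>; lea b \<alpha> \<beta>; \<epsilon> (\<phi> \<cdot> \<beta>) = 1\<rbrakk> \<Longrightarrow> lea b (\<pi> \<alpha>) (\<pi> \<beta>)"
    "\<And>\<alpha> \<beta>. \<lbrakk>\<alpha> \<in> P b; \<beta> \<in> P b; \<phi> \<cdot> \<alpha> = \<phi> \<cdot> \<beta>; lea b \<alpha> \<beta>; \<epsilon> (\<phi> \<cdot> \<beta>) \<noteq> 1\<rbrakk> \<Longrightarrow> lea b (\<pi> \<beta>) (\<pi> \<alpha>)"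
  using assms by (auto simp: twists_def)

lemma twists_cong:
  assumes "twists \<phi> \<psi> \<sigma> \<epsilon> \<pi> b a"
    "\<And>i. i \<in> P a \<Longrightarrow> \<sigma> i = \<sigma>' i" "\<And>i. i \<in> P a \<Longrightarrow> \<epsilon> i = \<epsilon>' i"
  shows "twists \<phi> \<psi> \<sigma>' \<epsilon>' \<pi> b a"
proof -
  note D = twistsD[OF assms(1)]
  show ?thesis
    using D assms(2,3)[OF comp_P[OF D(1)]] by (intro twistsI) auto
qed

text \<open>The pushforwards are monotone and rearrange each other, hence agree on all arrows out of
  \<open>s\<close>; the generator then separates no further.\<close>

lemma rearrangement_unique:
  assumes "\<psi> \<in> Hom C b a" "\<psi>' \<in> Hom C b a" "\<pi> \<in> Bij (P b)" "\<pi>' \<in> Bij (P b)"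
    "\<And>\<alpha>. \<alpha> \<in> P b \<Longrightarrow> \<psi> \<cdot> \<pi> \<alpha> = \<psi>' \<cdot> \<pi>' \<alpha>"
  shows "\<psi> = \<psi>'"
proof (rule faithful[OF assms(1,2)])
  fix \<alpha> assume \<alpha>: "\<alpha> \<in> P b"
  obtain \<rho> where \<rho>: "\<rho> \<in> Bij (P b)" "\<And>x. x \<in> P b \<Longrightarrow> \<pi> (\<rho> x) = x"
    using Bij_inverseE[OF assms(3)] by metis
  show "\<psi> \<cdot> \<alpha> = \<psi>' \<cdot> \<alpha>"
  proof (rule monotone_rearrangement_unique[OF chain[OF Hom_Obj(1)] chain[OF Hom_Obj(2)],
        OF assms(1,1), where g = "\<lambda>x. \<psi> \<cdot> x" and g' = "\<lambda>x. \<psi>' \<cdot> x"])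
    show "bij_betw (compose (P b) \<pi>' \<rho>) (P b) (P b)"
      using compose_Bij[OF assms(4) \<rho>(1)] by (simp add: Bij_def)
    show "\<psi> \<cdot> x = \<psi>' \<cdot> compose (P b) \<pi>' \<rho> x" if "x \<in> P b" for x
      using that \<rho> assms(5)[of "\<rho> x"] by (simp add: compose_def Bij_apply)
  qed (use \<alpha> assms(1,2) Hom_Obj in \<open>auto simp: comp_P monotone_on_def comp_monotone\<close>)
qed

text \<open>The arrow is fixed by the sorted list of its values. For the permutations,
  \<open>\<pi>'\<close> after the inverse of \<open>\<pi>\<close> preserves the fibres of
  \<open>\<psi>\<close> and within each reverses the order twice or not at all, so it is
  monotone.\<close>

lemma twists_unique:
  assumes tw: "twists \<phi> \<psi> \<sigma> \<epsilon> \<pi> b a" and tw': "twists \<phi> \<psi>' \<sigma> \<epsilon> \<pi>' b a" and \<sigma>: "\<sigma> \<in> Bij (P a)"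
  shows "\<psi> = \<psi>'" "\<pi> = \<pi>'"
proof -
  note D = twistsD[OF tw] and D' = twistsD[OF tw']
  show eq: "\<psi> = \<psi>'"
    using rearrangement_unique[OF D(2) D'(2) D(3) D'(3)] D(4) D'(4) by metis
  obtain \<rho> where \<rho>: "\<rho> \<in> Bij (P b)" "\<And>x. x \<in> P b \<Longrightarrow> \<rho> (\<pi> x) = x" "\<And>x. x \<in> P b \<Longrightarrow> \<pi> (\<rho> x) = x"
    using Bij_inverseE[OF D(3)] by metis
  let ?\<kappa> = "\<lambda>x. \<pi>' (\<rho> x)"
  have \<kappa>: "?\<kappa> x \<in> P b" if "x \<in> P b" for x
    using that \<rho>(1) D'(3) by (simp add: Bij_apply)
  have \<psi>\<kappa>: "\<psi> \<cdot> ?\<kappa> x = \<psi> \<cdot> x" if "x \<in> P b" for x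
    using that \<rho> D(4)[of "\<rho> x"] D'(4)[of "\<rho> x"] eq by (simp add: Bij_apply)
  have b: "b \<in> Obj C" using D(1) Hom_Obj by blast
  \<comment> \<open>A monotone bijection of a finite chain is a monotone rearrangement of the
    identity, hence equal to it.\<close>
  have "?\<kappa> x = x" if x: "x \<in> P b" for x
  proof (rule monotone_rearrangement_unique[OF chain[OF b] chain[OF b], where g = "\<lambda>x. ?\<kappa> x" and g' = "\<lambda>x. x"])
    show "monotone_on (P b) (lea b) (lea b) ?\<kappa>"
    proof (rule monotone_onI, rule ccontr)
      fix x y assume x: "x \<in> P b" and y: "y \<in> P b" and xy: "lea b x y" and n: "\<not> lea b (?\<kappa> x) (?\<kappa> y)"
      then have yx: "lea b (?\<kappa> y) (?\<kappa> x)" using le_total \<kappa> by blast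
      \<comment> \<open>As \<open>?\<kappa>\<close> does not change values of \<open>\<psi>\<close>,
        an inversion can occur only inside one fibre of \<open>\<psi>\<close>, which comes from one
        fibre of \<open>\<phi>\<close> because \<open>\<sigma>\<close> is injective.\<close>
      have "lea a (\<psi> \<cdot> y) (\<psi> \<cdot> x)" "lea a (\<psi> \<cdot> x) (\<psi> \<cdot> y)"
        using comp_monotone[OF D(2) yx] \<psi>\<kappa> x y comp_monotone[OF D(2) xy] by auto
      then have "\<psi> \<cdot> x = \<psi> \<cdot> y" using le_antisym comp_P D(2) x y by blast
      then have "\<sigma> (\<phi> \<cdot> \<rho> x) = \<sigma> (\<phi> \<cdot> \<rho> y)"
        using D(4) \<rho> x y by (simp add: Bij_apply)
      then have fib: "\<phi> \<cdot> \<rho> x = \<phi> \<cdot> \<rho> y"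
        using Bij_eqD[OF \<sigma>] comp_P D(1) \<rho>(1) x y by (simp add: Bij_apply)
      have R: "\<rho> x \<in> P b" "\<rho> y \<in> P b" using \<rho>(1) x y by (auto simp: Bij_apply)
      show False
      proof (cases "lea b (\<rho> x) (\<rho> y)")
        case True
        show False
        proof (cases "\<epsilon> (\<phi> \<cdot> \<rho> y) = 1")
          case True
          with D'(5) R fib \<open>lea b (\<rho> x) (\<rho> y)\<close> n show False by blast
        next
          case False
          then have "lea b y x" using D(6)[OF R fib \<open>lea b (\<rho> x) (\<rho> y)\<close>] \<rho>(3) x y by simp
          with xy x y le_antisym have "x = y" by blast
          with n le_refl \<kappa> x show False by blast
        qed
      next
        case False
        then have yx': "lea b (\<rho> y) (\<rho> x)" using R le_total by blast
        show False
        proof (cases "\<epsilon> (\<phi> \<cdot> \<rho> x) = 1")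
          case True
          then have "lea b y x" using D(5)[OF R(2,1) fib[symmetric] yx'] \<rho>(3) x y by simp
          with xy x y le_antisym have "x = y" by blast
          with n le_refl \<kappa> x show False by blast
        next
          case False
          with D'(6)[OF R(2,1) fib[symmetric] yx'] n show False by blast
        qed
      qed
    qed
    show "bij_betw ?\<kappa> (P b) (P b)"
      using bij_betw_trans[of \<rho> "P b" "P b" \<pi>' "P b"] \<rho>(1) D'(3) by (simp add: Bij_def comp_def)
  qed (use x \<kappa> in \<open>auto simp: monotone_on_def\<close>)
  then have "\<pi>' x = \<pi> x" if "x \<in> P b" for x
    using that \<rho>(2) D(3) by (metis Bij_apply)
  then show "\<pi> = \<pi>'" using D(3) D'(3) by (metis Bij_eqI)
qed

text \<open>Resolves the definite description in \<open>perm_act\<close>: two candidates differ by a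
  permutation of the source, so they are the same sorted list.\<close>

lemma push_act_unique:
  assumes \<sigma>: "\<sigma> \<in> Bij (P a)" and \<phi>: "\<phi> \<in> Hom C b a" and g: "g \<in> Pos (P b) (lea b) (P a) (lea a)"
    and \<pi>: "\<pi> \<in> Bij (P b)" "\<And>\<alpha>. \<alpha> \<in> P b \<Longrightarrow> \<sigma> (\<phi> \<cdot> \<alpha>) = g (\<pi> \<alpha>)"
  shows "pact \<sigma> \<phi> = g"
  unfolding push_act_def perm_act_def
proof (rule the_equality)
  have D: "Dom C \<phi> = b" "Cod C \<phi> = a" using Hom_D[OF \<phi>] by auto
  have comp: "compose (P b) \<sigma> (push C s \<phi>) = compose (P b) h \<rho> \<longleftrightarrow> (\<forall>\<alpha>\<in>P b. \<sigma> (\<phi> \<cdot> \<alpha>) = h (\<rho> \<alpha>))" for h :: "'m \<Rightarrow> 'm" and \<rho> :: "'m \<Rightarrow> 'm"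
    using \<phi> by (auto simp: compose_def push_apply fun_eq_iff)
  show "g \<in> Pos (P (Dom C \<phi>)) (lea (Dom C \<phi>)) (P (Cod C \<phi>)) (lea (Cod C \<phi>)) \<and>
    (\<exists>\<sigma>'\<in>Bij (P (Dom C \<phi>)). compose (P (Dom C \<phi>)) \<sigma> (push C s \<phi>) = compose (P (Dom C \<phi>)) g \<sigma>')"
    using g \<pi> by (auto simp: D comp)
  fix h assume "h \<in> Pos (P (Dom C \<phi>)) (lea (Dom C \<phi>)) (P (Cod C \<phi>)) (lea (Cod C \<phi>)) \<and>
    (\<exists>\<sigma>'\<in>Bij (P (Dom C \<phi>)). compose (P (Dom C \<phi>)) \<sigma> (push C s \<phi>) = compose (P (Dom C \<phi>)) h \<sigma>')"
  then obtain \<rho> where h: "h \<in> Pos (P b) (lea b) (P a) (lea a)" and \<rho>: "\<rho> \<in> Bij (P b)"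
    "\<And>\<alpha>. \<alpha> \<in> P b \<Longrightarrow> \<sigma> (\<phi> \<cdot> \<alpha>) = h (\<rho> \<alpha>)" unfolding D comp by blast
  obtain \<kappa> where \<kappa>: "\<kappa> \<in> Bij (P b)" "\<And>x. x \<in> P b \<Longrightarrow> \<pi> (\<kappa> x) = x"
    using Bij_inverseE[OF \<pi>(1)] by metis
  have "g x = h x" if x: "x \<in> P b" for x
  proof (rule monotone_rearrangement_unique[OF chain[OF Hom_Obj(1)] chain[OF Hom_Obj(2)],
        OF \<phi> \<phi>, where g = g and g' = h])
    show "bij_betw (compose (P b) \<rho> \<kappa>) (P b) (P b)"
      using compose_Bij[OF \<rho>(1) \<kappa>(1)] by (simp add: Bij_def)
    show "g x = h (compose (P b) \<rho> \<kappa> x)" if "x \<in> P b" for x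
      using that \<kappa> \<rho>(2)[of "\<kappa> x"] \<pi>(2)[of "\<kappa> x"] by (simp add: compose_def Bij_apply)
  qed (use x g h Hom_Obj[OF \<phi>] in \<open>auto simp: Pos_def\<close>)
  then show "h = g" using g h PiE_ext[of h "P b" "\<lambda>_. P a" g] by (simp add: Pos_def)
qed

text \<open>For a mere bijection \<open>\<sigma>\<close> the sorted map need not come from an arrow,
  so the square is stated with \<open>pact \<sigma> \<phi>\<close>; membership in
  \<open>syms a\<close> later supplies the arrow.\<close>

lemma push_actE:
  assumes \<sigma>: "\<sigma> \<in> Bij (P a)" and \<phi>: "\<phi> \<in> Hom C b a"
  obtains \<pi> where "\<pi> \<in> Bij (P b)" "\<And>\<alpha>. \<alpha> \<in> P b \<Longrightarrow> \<sigma> (\<phi> \<cdot> \<alpha>) = pact \<sigma> \<phi> (\<pi> \<alpha>)"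
    "\<And>\<alpha> \<beta>. \<lbrakk>\<alpha> \<in> P b; \<beta> \<in> P b; \<phi> \<cdot> \<alpha> = \<phi> \<cdot> \<beta>; lea b \<alpha> \<beta>\<rbrakk>
      \<Longrightarrow> if \<epsilon> (\<phi> \<cdot> \<alpha>) = (1::int) then lea b (\<pi> \<alpha>) (\<pi> \<beta>) else lea b (\<pi> \<beta>) (\<pi> \<alpha>)"
proof -
  \<comment> \<open>The tie rule of the sorting lemma sees only the value
    \<open>\<sigma> (\<phi> \<cdot> x)\<close>; the inverse \<open>\<tau>\<close> recovers the index
    at which the sign is read.\<close>
  obtain \<tau> where \<tau>: "\<And>x. x \<in> P a \<Longrightarrow> \<tau> (\<sigma> x) = x" using Bij_inverseE[OF \<sigma>] by metis
  have "(\<lambda>x. \<sigma> (\<phi> \<cdot> x)) \<in> P b \<rightarrow> P a"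
    using Bij_apply[OF \<sigma>] comp_P[OF \<phi>] by simp
  then obtain \<pi> g where \<pi>: "bij_betw \<pi> (P b) (P b)"
    and g: "g \<in> P b \<rightarrow> P a" "monotone_on (P b) (lea b) (lea a) g"
    and eq: "\<And>x. x \<in> P b \<Longrightarrow> \<sigma> (\<phi> \<cdot> x) = g (\<pi> x)"
    and tie: "\<And>x y. \<lbrakk>x \<in> P b; y \<in> P b; \<sigma> (\<phi> \<cdot> x) = \<sigma> (\<phi> \<cdot> y); lea b x y\<rbrakk>
      \<Longrightarrow> if \<epsilon> (\<tau> (\<sigma> (\<phi> \<cdot> x))) = 1 then lea b (\<pi> x) (\<pi> y) else lea b (\<pi> y) (\<pi> x)"
    by (rule monotone_rearrangement_exists[OF chain[OF Hom_Obj(1)[OF \<phi>]] chain[OF Hom_Obj(2)[OF \<phi>]],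
        where e = "\<lambda>i. \<epsilon> (\<tau> i) = 1"]) blast
  have "pact \<sigma> \<phi> = restrict g (P b)"
  proof (rule push_act_unique[OF \<sigma> \<phi>])
    show "restrict g (P b) \<in> Pos (P b) (lea b) (P a) (lea a)"
      using g by (auto simp: Pos_def monotone_on_def)
    show "restrict \<pi> (P b) \<in> Bij (P b)" using \<pi> by (simp add: Bij_def)
    show "\<sigma> (\<phi> \<cdot> \<alpha>) = restrict g (P b) (restrict \<pi> (P b) \<alpha>)" if "\<alpha> \<in> P b" for \<alpha>
      using that eq \<pi> by (simp add: bij_betw_apply)
  qed
  then have pact: "pact \<sigma> \<phi> (\<pi> x) = g (\<pi> x)" if "x \<in> P b" for x
    using that \<pi> by (simp add: bij_betw_apply)
  show thesis
  proof (rule that)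
    show "restrict \<pi> (P b) \<in> Bij (P b)" using \<pi> by (simp add: Bij_def)
    show "\<sigma> (\<phi> \<cdot> x) = pact \<sigma> \<phi> (restrict \<pi> (P b) x)" if "x \<in> P b" for x
      using that pact eq by simp
    show "if \<epsilon> (\<phi> \<cdot> x) = 1 then lea b (restrict \<pi> (P b) x) (restrict \<pi> (P b) y)
        else lea b (restrict \<pi> (P b) y) (restrict \<pi> (P b) x)"
      if "x \<in> P b" "y \<in> P b" "\<phi> \<cdot> x = \<phi> \<cdot> y" "lea b x y" for x y
      using tie[OF that(1,2) _ that(4)] that \<tau>[OF comp_P[OF \<phi>]] by simp
  qed
qed

text \<open>Any rearranging permutation will do, so a \<open>twists\<close> square with arbitrary
  signs can serve as evidence.\<close>

lemma sym_permsI: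
  assumes "\<sigma> \<in> Bij (P a)"
    and "\<And>b \<phi>. \<phi> \<in> Hom C b a
      \<Longrightarrow> \<exists>\<psi>\<in>Hom C b a. \<exists>\<pi>\<in>Bij (P b). \<forall>\<alpha>\<in>P b. \<sigma> (\<phi> \<cdot> \<alpha>) = \<psi> \<cdot> \<pi> \<alpha>"
  shows "\<sigma> \<in> syms a"
  unfolding sym_perms_def
proof (intro CollectI conjI ballI)
  fix b \<phi> assume \<phi>: "\<phi> \<in> Hom C b a"
  from assms(2)[OF \<phi>] obtain \<psi> \<pi> where \<psi>: "\<psi> \<in> Hom C b a" and \<pi>: "\<pi> \<in> Bij (P b)"
    and eq: "\<forall>\<alpha>\<in>P b. \<sigma> (\<phi> \<cdot> \<alpha>) = \<psi> \<cdot> \<pi> \<alpha>" by blast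
  have "pact \<sigma> \<phi> = push C s \<psi>"
    by (rule push_act_unique[OF assms(1) \<phi> push_Pos[OF \<psi>] \<pi>])
      (use eq \<psi> \<pi> in \<open>auto simp: push_apply Bij_apply\<close>)
  with \<psi> show "pact \<sigma> \<phi> \<in> push C s ` Hom C b a" by blast
qed (fact assms(1))

lemma syms_Bij: "\<sigma> \<in> syms a \<Longrightarrow> \<sigma> \<in> Bij (P a)"
  by (simp add: sym_perms_def)

text \<open>Signs decide only how ties are sorted and never affect the arrow, so squares exist for
  every \<open>\<epsilon>\<close>.\<close>

lemma sym_perms_twists:
  assumes \<sigma>: "\<sigma> \<in> syms a" and \<phi>: "\<phi> \<in> Hom C b a"
  obtains \<psi> \<pi> where "twists \<phi> \<psi> \<sigma> \<epsilon> \<pi> b a"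
proof -
  obtain \<pi> where \<pi>: "\<pi> \<in> Bij (P b)" "\<And>\<alpha>. \<alpha> \<in> P b \<Longrightarrow> \<sigma> (\<phi> \<cdot> \<alpha>) = pact \<sigma> \<phi> (\<pi> \<alpha>)"
    "\<And>\<alpha> \<beta>. \<lbrakk>\<alpha> \<in> P b; \<beta> \<in> P b; \<phi> \<cdot> \<alpha> = \<phi> \<cdot> \<beta>; lea b \<alpha> \<beta>\<rbrakk>
      \<Longrightarrow> if \<epsilon> (\<phi> \<cdot> \<alpha>) = (1::int) then lea b (\<pi> \<alpha>) (\<pi> \<beta>) else lea b (\<pi> \<beta>) (\<pi> \<alpha>)"
    by (rule push_actE[OF syms_Bij[OF \<sigma>] \<phi>, where \<epsilon> = \<epsilon>]) blast
  obtain \<psi> where \<psi>: "\<psi> \<in> Hom C b a" "pact \<sigma> \<phi> = push C s \<psi>"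
    using \<sigma> \<phi> Hom_Obj[OF \<phi>] unfolding sym_perms_def by blast
  have "\<sigma> (\<phi> \<cdot> x) = \<psi> \<cdot> \<pi> x" if "x \<in> P b" for x
    using \<pi>(1,2) \<psi> that by (simp add: push_apply Bij_apply)
  with \<phi> \<psi>(1) \<pi>(1,3) have "twists \<phi> \<psi> \<sigma> \<epsilon> \<pi> b a"
    unfolding twists_def by blast
  then show thesis by (rule that)
qed

lemma sym_act_eq:
  assumes \<sigma>: "\<sigma> \<in> Bij (P a)" and tw: "twists \<phi> \<psi> \<sigma> \<epsilon> \<pi> b a"
  shows "sact \<sigma> \<phi> = \<psi>"
proof -
  note D = twistsD[OF tw]
  have "pact \<sigma> \<phi> = push C s \<psi>"
    by (rule push_act_unique[OF \<sigma> D(1) push_Pos[OF D(2)] D(3)])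
      (use D in \<open>auto simp: push_apply Bij_apply\<close>)
  then show ?thesis
    unfolding sym_act_def using D(1,2) Hom_D[OF D(1)] push_inj by (intro the_equality) auto
qed

section \<open>Pasting and inverting squares\<close>

lemma twists_id:
  assumes "\<phi> \<in> Hom C b a" shows "twists \<phi> \<phi> (\<lambda>i\<in>P a. i) (\<lambda>_. 1) (\<lambda>i\<in>P b. i) b a"
  using assms by (intro twistsI) (auto simp: id_Bij comp_P)

text \<open>The fibres of an identity are singletons, so all signs are compatible with it.\<close>

lemma twists_Ident:
  assumes "a \<in> Obj C" "\<sigma> \<in> Bij (P a)" shows "twists (Ident C a) (Ident C a) \<sigma> \<epsilon> \<sigma> a a"
proof (rule twistsI)
  fix \<alpha> assume \<alpha>: "\<alpha> \<in> P a"
  show "\<sigma> (Ident C a \<cdot> \<alpha>) = Ident C a \<cdot> \<sigma> \<alpha>"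
    using Comp_Ident_left[OF \<alpha>] Comp_Ident_left[OF Bij_apply[OF assms(2) \<alpha>]] by simp
next
  fix \<alpha> \<beta> assume "\<alpha> \<in> P a" "\<beta> \<in> P a" "Ident C a \<cdot> \<alpha> = Ident C a \<cdot> \<beta>"
  then have "\<alpha> = \<beta>" by (simp add: Comp_Ident_left)
  with \<open>\<beta> \<in> P a\<close> show "lea a (\<sigma> \<alpha>) (\<sigma> \<beta>)" "lea a (\<sigma> \<beta>) (\<sigma> \<alpha>)"
    using le_refl Bij_apply[OF assms(2)] by auto
qed (use assms Ident_in_Hom in auto)

text \<open>The fibre over \<open>i\<close> is oriented first by \<open>\<epsilon> i\<close> and
  then, as the fibre over \<open>\<sigma> i\<close>, by \<open>\<zeta> (\<sigma> i)\<close>.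
  Orientations multiply only when the signs really are \<open>1\<close> or \<open>-1\<close>, whence
  the last hypothesis.\<close>

lemma twists_vertical:
  assumes tw: "twists \<phi> \<psi> \<sigma> \<epsilon> \<pi> b a" and tw': "twists \<psi> \<chi> \<tau> \<zeta> \<rho> b a"
    and signs: "\<epsilon> ` P a \<subseteq> {1, -1}" "\<zeta> ` P a \<subseteq> {1, -1}"
  shows "twists \<phi> \<chi> (compose (P a) \<tau> \<sigma>) (\<lambda>i\<in>P a. \<zeta> (\<sigma> i) * \<epsilon> i) (compose (P b) \<rho> \<pi>) b a"
proof -
  note D = twistsD[OF tw] and D' = twistsD[OF tw']
  have \<pi>P: "\<pi> x \<in> P b" if "x \<in> P b" for x using Bij_apply[OF D(3)] that .
  have img: "\<epsilon> (\<phi> \<cdot> x) = 1 \<or> \<epsilon> (\<phi> \<cdot> x) = -1" "\<zeta> (\<psi> \<cdot> \<pi> x) = 1 \<or> \<zeta> (\<psi> \<cdot> \<pi> x) = -1" if "x \<in> P b" for x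
    using signs comp_P[OF D(1) that] comp_P[OF D(2) \<pi>P[OF that]] by auto
  have fib: "\<psi> \<cdot> \<pi> x = \<psi> \<cdot> \<pi> y" if "x \<in> P b" "y \<in> P b" "\<phi> \<cdot> x = \<phi> \<cdot> y" for x y
    using D(4) that by metis
  show ?thesis
  proof (rule twistsI)
    show "\<phi> \<in> Hom C b a" "\<chi> \<in> Hom C b a" by fact+
    show "compose (P b) \<rho> \<pi> \<in> Bij (P b)" using D(3) D'(3) by (rule compose_Bij[rotated])
    show "compose (P a) \<tau> \<sigma> (\<phi> \<cdot> x) = \<chi> \<cdot> compose (P b) \<rho> \<pi> x" if "x \<in> P b" for x
      using that D(1,4) D'(4) \<pi>P by (simp add: compose_def comp_P)
  next
    fix x y assume xy: "x \<in> P b" "y \<in> P b" "\<phi> \<cdot> x = \<phi> \<cdot> y" "lea b x y"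
    have val: "(\<lambda>i\<in>P a. \<zeta> (\<sigma> i) * \<epsilon> i) (\<phi> \<cdot> y) = \<zeta> (\<psi> \<cdot> \<pi> y) * \<epsilon> (\<phi> \<cdot> y)"
      using xy D(1,4) by (simp add: comp_P)
    have f: "\<psi> \<cdot> \<pi> x = \<psi> \<cdot> \<pi> y" using fib xy by blast
    show "lea b (compose (P b) \<rho> \<pi> x) (compose (P b) \<rho> \<pi> y)"
      if "(\<lambda>i\<in>P a. \<zeta> (\<sigma> i) * \<epsilon> i) (\<phi> \<cdot> y) = 1"
      using that img[OF xy(2)] D(5,6)[OF xy] D'(5)[OF \<pi>P[OF xy(1)] \<pi>P[OF xy(2)] f]
        D'(6)[OF \<pi>P[OF xy(2)] \<pi>P[OF xy(1)] f[symmetric]] f xy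
      unfolding val by (auto simp: compose_def)
    show "lea b (compose (P b) \<rho> \<pi> y) (compose (P b) \<rho> \<pi> x)"
      if "(\<lambda>i\<in>P a. \<zeta> (\<sigma> i) * \<epsilon> i) (\<phi> \<cdot> y) \<noteq> 1"
      using that img[OF xy(2)] D(5,6)[OF xy] D'(6)[OF \<pi>P[OF xy(1)] \<pi>P[OF xy(2)] f]
        D'(5)[OF \<pi>P[OF xy(2)] \<pi>P[OF xy(1)] f[symmetric]] f xy
      unfolding val by (auto simp: compose_def)
  qed
qed

text \<open>Two points in one fibre of \<open>\<phi> \<cdot> \<chi>\<close> either share a fibre of
  \<open>\<chi>\<close>, where \<open>\<rho>\<close> is oriented by the pulled-back sign, or have
  distinct images in one fibre of \<open>\<phi>\<close>, where \<open>\<pi>\<close> orders them with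
  the same sign.\<close>

lemma twists_horizontal:
  assumes tw: "twists \<phi> \<psi> \<sigma> \<epsilon> \<pi> b a" and tw': "twists \<chi> \<omega> \<pi> (\<lambda>j\<in>P b. \<epsilon> (\<phi> \<cdot> j)) \<rho> c b"
  shows "twists (\<phi> \<cdot> \<chi>) (\<psi> \<cdot> \<omega>) \<sigma> \<epsilon> \<rho> c a"
proof -
  note D = twistsD[OF tw] and D' = twistsD[OF tw']
  have \<rho>P: "\<rho> x \<in> P c" if "x \<in> P c" for x using Bij_apply[OF D'(3)] that .
  \<comment> \<open>The monotone map given by \<open>\<omega>\<close> reflects strict
    comparisons.\<close>
  have strict: "lea c (\<rho> x) (\<rho> y)"
    if "x \<in> P c" "y \<in> P c" "lea b (\<pi> (\<chi> \<cdot> x)) (\<pi> (\<chi> \<cdot> y))" "\<chi> \<cdot> x \<noteq> \<chi> \<cdot> y" for x y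
  proof (rule ccontr)
    assume "\<not> lea c (\<rho> x) (\<rho> y)"
    then have "lea c (\<rho> y) (\<rho> x)" using le_total \<rho>P that by blast
    then have "lea b (\<omega> \<cdot> \<rho> y) (\<omega> \<cdot> \<rho> x)" using comp_monotone D'(2) by blast
    moreover have "lea b (\<omega> \<cdot> \<rho> x) (\<omega> \<cdot> \<rho> y)" using that D'(4) by simp
    ultimately have "\<omega> \<cdot> \<rho> x = \<omega> \<cdot> \<rho> y"
      using le_antisym[of "\<omega> \<cdot> \<rho> x" b "\<omega> \<cdot> \<rho> y"] comp_P[OF D'(2) \<rho>P] that(1,2) by blast
    then have "\<pi> (\<chi> \<cdot> x) = \<pi> (\<chi> \<cdot> y)" using that D'(4) by simp
    with Bij_eqD[OF D(3)] comp_P[OF D'(1)] that show False by blast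
  qed
  show ?thesis
  proof (rule twistsI)
    show "\<phi> \<cdot> \<chi> \<in> Hom C c a" "\<psi> \<cdot> \<omega> \<in> Hom C c a"
      using D(1,2) D'(1,2) Comp_in_Hom by blast+
    show "\<rho> \<in> Bij (P c)" by fact
    show "\<sigma> ((\<phi> \<cdot> \<chi>) \<cdot> x) = (\<psi> \<cdot> \<omega>) \<cdot> \<rho> x" if "x \<in> P c" for x
      using that D(1,2,4) D'(1,2,4) \<rho>P by (simp add: Comp_assoc[where a=s and b=c and c=b and d=a] comp_P)
  next
    fix x y assume x: "x \<in> P c" and y: "y \<in> P c" and f: "(\<phi> \<cdot> \<chi>) \<cdot> x = (\<phi> \<cdot> \<chi>) \<cdot> y" and le: "lea c x y"
    have as: "(\<phi> \<cdot> \<chi>) \<cdot> z = \<phi> \<cdot> (\<chi> \<cdot> z)" if "z \<in> P c" for z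
      using that D(1) D'(1) by (simp add: Comp_assoc)
    have fib: "\<phi> \<cdot> (\<chi> \<cdot> x) = \<phi> \<cdot> (\<chi> \<cdot> y)" using f as x y by simp
    have X: "\<chi> \<cdot> x \<in> P b" "\<chi> \<cdot> y \<in> P b" using D'(1) x y comp_P by blast+
    have le': "lea b (\<chi> \<cdot> x) (\<chi> \<cdot> y)" using comp_monotone[OF D'(1) le] .
    show "lea c (\<rho> x) (\<rho> y)" if "\<epsilon> ((\<phi> \<cdot> \<chi>) \<cdot> y) = 1"
      using that D'(5)[OF x y _ le] strict[OF x y D(5)[OF X fib le']] X as[OF y]
      by (cases "\<chi> \<cdot> x = \<chi> \<cdot> y") auto
    show "lea c (\<rho> y) (\<rho> x)" if "\<epsilon> ((\<phi> \<cdot> \<chi>) \<cdot> y) \<noteq> 1"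
      using that D'(6)[OF x y _ le] strict[OF y x D(6)[OF X fib le']] X as[OF y]
      by (cases "\<chi> \<cdot> x = \<chi> \<cdot> y") auto
  qed
qed

text \<open>The inverse of a reversal is a reversal, so the signs keep their values and are only
  reindexed by \<open>\<tau>\<close>.\<close>

lemma twists_inverse:
  assumes tw: "twists \<phi> \<psi> \<sigma> \<epsilon> \<pi> b a"
    and \<tau>: "\<And>i. i \<in> P a \<Longrightarrow> \<tau> (\<sigma> i) = i" and \<sigma>: "\<sigma> \<in> Bij (P a)"
    and \<rho>: "\<rho> \<in> Bij (P b)" "\<And>x. x \<in> P b \<Longrightarrow> \<pi> (\<rho> x) = x"
  shows "twists \<psi> \<phi> \<tau> (\<lambda>i. \<epsilon> (\<tau> i)) \<rho> b a"
proof -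
  note D = twistsD[OF tw]
  have R: "\<rho> x \<in> P b" if "x \<in> P b" for x using Bij_apply[OF \<rho>(1)] that .
  have eq: "\<tau> (\<psi> \<cdot> x) = \<phi> \<cdot> \<rho> x" if "x \<in> P b" for x
    using that D(4)[OF R] \<rho>(2) \<tau> comp_P[OF D(1) R] by metis
  have E: "\<rho> x = \<rho> y" if "x \<in> P b" "y \<in> P b" "lea b x y" "lea b y x" for x y
    using that le_antisym by blast
  show ?thesis
  proof (rule twistsI)
    show "\<psi> \<in> Hom C b a" "\<phi> \<in> Hom C b a" "\<rho> \<in> Bij (P b)" by fact+
    show "\<tau> (\<psi> \<cdot> x) = \<phi> \<cdot> \<rho> x" if "x \<in> P b" for x using eq that .
  next
    fix x y assume x: "x \<in> P b" and y: "y \<in> P b" and f: "\<psi> \<cdot> x = \<psi> \<cdot> y" and le: "lea b x y"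
    have fib: "\<phi> \<cdot> \<rho> x = \<phi> \<cdot> \<rho> y" using f eq x y by metis
    note F = eq[OF y] \<rho>(2)[OF x] \<rho>(2)[OF y] E[OF x y le] le_refl[OF R[OF x]]
    \<comment> \<open>If the order of \<open>\<rho> x\<close> and \<open>\<rho> y\<close> is the
      wrong one, applying \<open>\<pi>\<close> gives \<open>y \<le> x\<close>, so
      \<open>x = y\<close> and both orders hold.\<close>
    have t: "lea b (\<rho> x) (\<rho> y) \<or> lea b (\<rho> y) (\<rho> x)" using le_total R x y by blast
    show "lea b (\<rho> x) (\<rho> y)" if "\<epsilon> (\<tau> (\<psi> \<cdot> y)) = 1"
      using that t D(5)[OF R[OF y] R[OF x] fib[symmetric]] fib F by auto
    show "lea b (\<rho> y) (\<rho> x)" if "\<epsilon> (\<tau> (\<psi> \<cdot> y)) \<noteq> 1"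
      using that t D(6)[OF R[OF x] R[OF y] fib] fib F by auto
  qed
qed

section \<open>The Weyl crossed group\<close>

lemma fiber_iff: "\<phi> \<in> Hom C b a \<Longrightarrow> \<alpha> \<in> fiber C s \<phi> i \<longleftrightarrow> \<alpha> \<in> P b \<and> \<phi> \<cdot> \<alpha> = i"
  using Hom_D[of \<phi> b a] push_apply[of \<phi> b a \<alpha>] by (auto simp: fiber_def)

text \<open>The conditions in \<open>pull_perm\<close> are those of a square with constant sign
  \<open>1\<close>.\<close>

lemma pull_perm_eq:
  assumes \<sigma>: "\<sigma> \<in> Bij (P a)" and tw: "twists \<phi> \<psi> \<sigma> (\<lambda>_. 1) \<pi> b a"
  shows "pull_perm C s sbar \<iota>\<^sub>0 \<iota>\<^sub>1 \<phi> \<sigma> = \<pi>"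
proof -
  note D = twistsD[OF tw]
  have dc: "Dom C \<phi> = b" "Cod C \<phi> = a" using Hom_D[OF D(1)] by auto
  have F: "\<alpha> \<in> fiber C s \<phi> i \<longleftrightarrow> \<alpha> \<in> P b \<and> \<phi> \<cdot> \<alpha> = i"
    and F': "\<alpha> \<in> fiber C s \<psi> i \<longleftrightarrow> \<alpha> \<in> P b \<and> \<psi> \<cdot> \<alpha> = i" for \<alpha> i
    by (rule fiber_iff[OF D(1)], rule fiber_iff[OF D(2)])
  show ?thesis
    unfolding pull_perm_def dc sym_act_eq[OF \<sigma> tw]
  proof (rule the_equality, intro conjI ballI)
    show "\<pi> \<in> Bij (P b)" by (rule D(3))
    show "compose (P b) \<sigma> (push C s \<phi>) = compose (P b) (push C s \<psi>) \<pi>"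
      unfolding compose_def
      by (rule restrict_ext) (simp add: push_apply[OF D(1)] push_apply[OF D(2)] D(4) Bij_apply[OF D(3)])
    show "\<pi> \<in> fiber C s \<phi> i \<rightarrow> fiber C s \<psi> (\<sigma> i)" for i
      using D(4) Bij_apply[OF D(3)] by (auto simp: F F')
    show "monotone_on (fiber C s \<phi> i) (lea b) (lea b) \<pi>" for i
      by (rule monotone_onI) (use D(5) in \<open>auto simp: F\<close>)
  next
    fix \<pi>' assume \<pi>': "\<pi>' \<in> Bij (P b) \<and> compose (P b) \<sigma> (push C s \<phi>) = compose (P b) (push C s \<psi>) \<pi>' \<and>
      (\<forall>i\<in>P a. \<pi>' \<in> fiber C s \<phi> i \<rightarrow> fiber C s \<psi> (\<sigma> i) \<and> monotone_on (fiber C s \<phi> i) (lea b) (lea b) \<pi>')"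
    have "twists \<phi> \<psi> \<sigma> (\<lambda>_. 1) \<pi>' b a"
    proof (rule twistsI[OF D(1,2)])
      show "\<pi>' \<in> Bij (P b)" using \<pi>' by blast
      fix \<alpha> assume \<alpha>: "\<alpha> \<in> P b"
      then have "\<alpha> \<in> fiber C s \<phi> (\<phi> \<cdot> \<alpha>)" using F by blast
      moreover have "\<pi>' \<in> fiber C s \<phi> (\<phi> \<cdot> \<alpha>) \<rightarrow> fiber C s \<psi> (\<sigma> (\<phi> \<cdot> \<alpha>))"
        using \<pi>' comp_P[OF D(1) \<alpha>] by blast
      ultimately have "\<pi>' \<alpha> \<in> fiber C s \<psi> (\<sigma> (\<phi> \<cdot> \<alpha>))" by (rule funcset_mem[rotated])
      then show "\<sigma> (\<phi> \<cdot> \<alpha>) = \<psi> \<cdot> \<pi>' \<alpha>" unfolding F' by simp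
    next
      fix \<alpha> \<beta> assume "\<alpha> \<in> P b" "\<beta> \<in> P b" "\<phi> \<cdot> \<alpha> = \<phi> \<cdot> \<beta>" "lea b \<alpha> \<beta>"
      moreover from this have "monotone_on (fiber C s \<phi> (\<phi> \<cdot> \<alpha>)) (lea b) (lea b) \<pi>'"
        using \<pi>' comp_P[OF D(1)] by blast
      ultimately show "lea b (\<pi>' \<alpha>) (\<pi>' \<beta>)" by (simp add: monotone_on_def F)
    qed simp
    then show "\<pi>' = \<pi>" using twists_unique(2)[OF _ tw \<sigma>] by blast
  qed
qed

text \<open>The conditions in \<open>flip_fibers\<close> are those of a square over the identity
  permutation.\<close>

lemma flip_fibers_eq:
  assumes tw: "twists \<phi> \<phi> (\<lambda>i\<in>P a. i) \<epsilon> \<pi> b a"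
  shows "flip_fibers C s sbar \<iota>\<^sub>0 \<iota>\<^sub>1 \<phi> \<epsilon> = \<pi>"
proof -
  note D = twistsD[OF tw]
  have dc: "Dom C \<phi> = b" "Cod C \<phi> = a" using Hom_D[OF D(1)] by auto
  have F: "\<alpha> \<in> fiber C s \<phi> i \<longleftrightarrow> \<alpha> \<in> P b \<and> \<phi> \<cdot> \<alpha> = i" for \<alpha> i
    by (rule fiber_iff[OF D(1)])
  have fix_fiber: "\<phi> \<cdot> \<pi> \<alpha> = \<phi> \<cdot> \<alpha>" if "\<alpha> \<in> P b" for \<alpha>
    using D(4)[OF that] comp_P[OF D(1) that] by simp
  show ?thesis
    unfolding flip_fibers_def dc
  proof (rule the_equality, intro conjI ballI)
    show "\<pi> \<in> Bij (P b)" by (rule D(3))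
    show "bij_betw \<pi> (fiber C s \<phi> i) (fiber C s \<phi> i)" for i
    proof -
      have sub: "fiber C s \<phi> i \<subseteq> P b" by (auto simp: F)
      have inj: "inj_on \<pi> (fiber C s \<phi> i)"
        using D(3) sub by (auto simp: Bij_def bij_betw_def intro: inj_on_subset)
      moreover have "\<pi> ` fiber C s \<phi> i \<subseteq> fiber C s \<phi> i"
        using fix_fiber Bij_apply[OF D(3)] by (auto simp: F)
      ultimately show ?thesis
        using endo_inj_surj[OF finite_subset[OF sub finite_Hom]] by (simp add: bij_betw_def)
    qed
    show "if \<epsilon> i = 1 then monotone_on (fiber C s \<phi> i) (lea b) (lea b) \<pi>
        else monotone_on (fiber C s \<phi> i) (lea b) (\<lambda>\<alpha> \<alpha>'. lea b \<alpha>' \<alpha>) \<pi>" for i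
      using D(5,6) by (simp add: monotone_on_def F)
  next
    fix \<pi>' assume "\<pi>' \<in> Bij (P b) \<and> (\<forall>i\<in>P a. bij_betw \<pi>' (fiber C s \<phi> i) (fiber C s \<phi> i) \<and>
      (if \<epsilon> i = 1 then monotone_on (fiber C s \<phi> i) (lea b) (lea b) \<pi>'
        else monotone_on (fiber C s \<phi> i) (lea b) (\<lambda>\<alpha> \<alpha>'. lea b \<alpha>' \<alpha>) \<pi>'))"
    then have \<pi>': "\<pi>' \<in> Bij (P b)"
      and bij: "\<And>i. i \<in> P a \<Longrightarrow> bij_betw \<pi>' (fiber C s \<phi> i) (fiber C s \<phi> i)"
      and mono: "\<And>i. i \<in> P a \<Longrightarrow> if \<epsilon> i = 1 then monotone_on (fiber C s \<phi> i) (lea b) (lea b) \<pi>'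
        else monotone_on (fiber C s \<phi> i) (lea b) (\<lambda>\<alpha> \<alpha>'. lea b \<alpha>' \<alpha>) \<pi>'"
      by blast+
    have "twists \<phi> \<phi> (\<lambda>i\<in>P a. i) \<epsilon> \<pi>' b a"
    proof (rule twistsI[OF D(1,1) \<pi>'])
      fix \<alpha> assume \<alpha>: "\<alpha> \<in> P b"
      then have "\<pi>' \<alpha> \<in> fiber C s \<phi> (\<phi> \<cdot> \<alpha>)"
        using bij_betw_apply[OF bij[OF comp_P[OF D(1) \<alpha>]]] F by blast
      then show "(\<lambda>i\<in>P a. i) (\<phi> \<cdot> \<alpha>) = \<phi> \<cdot> \<pi>' \<alpha>" using comp_P[OF D(1) \<alpha>] F by simp
    next
      fix \<alpha> \<beta> assume ab: "\<alpha> \<in> P b" "\<beta> \<in> P b" "\<phi> \<cdot> \<alpha> = \<phi> \<cdot> \<beta>" "lea b \<alpha> \<beta>"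
      show "lea b (\<pi>' \<alpha>) (\<pi>' \<beta>)" if "\<epsilon> (\<phi> \<cdot> \<beta>) = 1"
        using mono[OF comp_P[OF D(1) ab(2)]] ab that by (simp add: monotone_on_def F)
      show "lea b (\<pi>' \<beta>) (\<pi>' \<alpha>)" if "\<epsilon> (\<phi> \<cdot> \<beta>) \<noteq> 1"
        using mono[OF comp_P[OF D(1) ab(2)]] ab that by (simp add: monotone_on_def F)
    qed
    then show "\<pi>' = \<pi>" using twists_unique(2)[OF _ tw id_Bij] by blast
  qed
qed

lemma id_syms: "(\<lambda>i\<in>P a. i) \<in> syms a"
  using twistsD[OF twists_id] by (intro sym_permsI id_Bij) blast

text \<open>The composite in \<open>weyl_perm\<close> is a vertical pasting of a flip over the
  identity and an order-preserving pull over \<open>\<sigma>\<close>, with signs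
  \<open>1 * \<epsilon> i\<close>; uniqueness of squares identifies it with
  \<open>\<pi>\<close>.\<close>

lemma weyl_perm_eq:
  assumes \<sigma>: "\<sigma> \<in> syms a" and \<epsilon>: "\<epsilon> \<in> P a \<rightarrow>\<^sub>E {1, -1}" and tw: "twists \<phi> \<psi> \<sigma> \<epsilon> \<pi> b a"
  shows "wperm \<phi> (\<sigma>, \<epsilon>) = \<pi>"
proof -
  note D = twistsD[OF tw]
  have \<sigma>': "\<sigma> \<in> Bij (P a)" using \<sigma> by (rule syms_Bij)
  obtain \<psi>\<^sub>1 \<pi>\<^sub>1 where "twists \<phi> \<psi>\<^sub>1 (\<lambda>i\<in>P a. i) \<epsilon> \<pi>\<^sub>1 b a"
    using sym_perms_twists[OF id_syms D(1)] .
  \<comment> \<open>A square over the identity permutation has both its arrows equal, since they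
    rearrange each other.\<close>
  moreover have "\<phi> = \<psi>\<^sub>1"
    by (rule rearrangement_unique[OF D(1) _ id_Bij])
      (use twistsD[OF calculation] comp_P[OF D(1)] in auto)
  ultimately have flip: "twists \<phi> \<phi> (\<lambda>i\<in>P a. i) \<epsilon> \<pi>\<^sub>1 b a" by simp
  obtain \<psi>\<^sub>2 \<pi>\<^sub>2 where pull: "twists \<phi> \<psi>\<^sub>2 \<sigma> (\<lambda>_. 1) \<pi>\<^sub>2 b a"
    using sym_perms_twists[OF \<sigma> D(1)] .
  have "twists \<phi> \<psi>\<^sub>2 (compose (P a) \<sigma> (\<lambda>i\<in>P a. i)) (\<lambda>i\<in>P a. 1 * \<epsilon> i) (compose (P b) \<pi>\<^sub>2 \<pi>\<^sub>1) b a"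
    by (rule twists_vertical[OF flip pull]) (use \<epsilon> in auto)
  then have "twists \<phi> \<psi>\<^sub>2 \<sigma> \<epsilon> (compose (P b) \<pi>\<^sub>2 \<pi>\<^sub>1) b a"
    by (rule twists_cong) (auto simp: compose_def)
  from twists_unique(2)[OF tw this \<sigma>'] show ?thesis
    by (simp add: weyl_perm_def Hom_D[OF D(1)] pull_perm_eq[OF \<sigma>' pull] flip_fibers_eq[OF flip])
qed

lemma compose_syms:
  assumes \<tau>: "\<tau> \<in> syms a" and \<sigma>: "\<sigma> \<in> syms a" shows "compose (P a) \<tau> \<sigma> \<in> syms a"
proof (rule sym_permsI)
  show "compose (P a) \<tau> \<sigma> \<in> Bij (P a)" using \<tau> \<sigma> by (intro compose_Bij syms_Bij)
  fix b \<phi> assume \<phi>: "\<phi> \<in> Hom C b a"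
  obtain \<psi> \<pi> where tw: "twists \<phi> \<psi> \<sigma> (\<lambda>_. 1) \<pi> b a" using sym_perms_twists[OF \<sigma> \<phi>] .
  obtain \<chi> \<rho> where tw': "twists \<psi> \<chi> \<tau> (\<lambda>_. 1) \<rho> b a" using sym_perms_twists[OF \<tau> twistsD(2)[OF tw]] .
  have "twists \<phi> \<chi> (compose (P a) \<tau> \<sigma>) (\<lambda>i\<in>P a. 1 * 1) (compose (P b) \<rho> \<pi>) b a"
    by (rule twists_vertical[OF tw tw']) auto
  from twistsD(2-4)[OF this] show "\<exists>\<psi>\<in>Hom C b a. \<exists>\<pi>\<in>Bij (P b). \<forall>\<alpha>\<in>P b. compose (P a) \<tau> \<sigma> (\<phi> \<cdot> \<alpha>) = \<psi> \<cdot> \<pi> \<alpha>"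
    by blast
qed

text \<open>Inverted squares give injectivity, and finiteness of the hom-set gives the rest. The
  inverse permutation is not yet known to lie in \<open>syms a\<close>; \<open>inverse_syms\<close>
  derives that from surjectivity here.\<close>

lemma sym_act_bij:
  assumes \<sigma>: "\<sigma> \<in> syms a" shows "bij_betw (sact \<sigma>) (Hom C b a) (Hom C b a)"
proof -
  have \<sigma>': "\<sigma> \<in> Bij (P a)" using \<sigma> by (rule syms_Bij)
  obtain \<tau> where \<tau>: "\<tau> \<in> Bij (P a)" "\<And>i. i \<in> P a \<Longrightarrow> \<tau> (\<sigma> i) = i"
    using Bij_inverseE[OF \<sigma>'] by metis
  have tw: "\<exists>\<pi>. twists \<phi> (sact \<sigma> \<phi>) \<sigma> (\<lambda>_. 1) \<pi> b a" if "\<phi> \<in> Hom C b a" for \<phi>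
    using sym_perms_twists[OF \<sigma> that] sym_act_eq[OF \<sigma>'] by metis
  have "inj_on (sact \<sigma>) (Hom C b a)"
  proof (rule inj_onI)
    fix \<phi> \<phi>' assume "\<phi> \<in> Hom C b a" "\<phi>' \<in> Hom C b a" and eq: "sact \<sigma> \<phi> = sact \<sigma> \<phi>'"
    then obtain \<pi> \<pi>' where t: "twists \<phi> (sact \<sigma> \<phi>) \<sigma> (\<lambda>_. 1) \<pi> b a"
      "twists \<phi>' (sact \<sigma> \<phi>) \<sigma> (\<lambda>_. 1) \<pi>' b a" using tw eq by metis
    have "\<exists>\<rho>. twists (sact \<sigma> \<phi>) \<phi> \<tau> (\<lambda>i. 1) \<rho> b a" if "twists \<phi> (sact \<sigma> \<phi>) \<sigma> (\<lambda>_. 1) \<pi> b a" for \<phi> \<pi>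
      using twists_inverse[OF that \<tau>(2) \<sigma>'] Bij_inverseE[OF twistsD(3)[OF that]] by metis
    then obtain \<rho> \<rho>' where "twists (sact \<sigma> \<phi>) \<phi> \<tau> (\<lambda>i. 1) \<rho> b a" "twists (sact \<sigma> \<phi>) \<phi>' \<tau> (\<lambda>i. 1) \<rho>' b a"
      using t eq by metis
    then show "\<phi> = \<phi>'" using twists_unique(1) \<tau>(1) by blast
  qed
  moreover have "sact \<sigma> ` Hom C b a \<subseteq> Hom C b a"
    using tw twistsD(2) by blast
  ultimately show ?thesis
    using endo_inj_surj[OF finite_Hom] by (simp add: bij_betw_def)
qed

section \<open>The group structure\<close>

lemma weyl_elementsI:
  assumes \<sigma>: "\<sigma> \<in> syms a" and \<epsilon>: "\<epsilon> \<in> P a \<rightarrow>\<^sub>E {1, -1}"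
    and "\<And>b \<phi>. \<phi> \<in> Hom C b a \<Longrightarrow> \<exists>\<psi> \<pi>. twists \<phi> \<psi> \<sigma> \<epsilon> \<pi> b a \<and> \<pi> \<in> syms b"
  shows "(\<sigma>, \<epsilon>) \<in> Wel a"
  unfolding weyl_elements_def
proof (intro CollectI conjI ballI)
  fix b \<phi> assume "\<phi> \<in> Hom C b a"
  with assms(3) obtain \<psi> \<pi> where "twists \<phi> \<psi> \<sigma> \<epsilon> \<pi> b a" "\<pi> \<in> syms b" by blast
  with weyl_perm_eq[OF \<sigma> \<epsilon>] show "wperm \<phi> (\<sigma>, \<epsilon>) \<in> syms b" by simp
qed (use \<sigma> \<epsilon> in \<open>simp add: signed_perms_def\<close>)

lemma weyl_elementsD:
  assumes "(\<sigma>, \<epsilon>) \<in> Wel a"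
  shows "\<sigma> \<in> syms a" "\<sigma> \<in> Bij (P a)" "\<epsilon> \<in> P a \<rightarrow>\<^sub>E {1, -1}"
    "\<phi> \<in> Hom C b a \<Longrightarrow> twists \<phi> (sact \<sigma> \<phi>) \<sigma> \<epsilon> (wperm \<phi> (\<sigma>, \<epsilon>)) b a"
    "\<phi> \<in> Hom C b a \<Longrightarrow> wperm \<phi> (\<sigma>, \<epsilon>) \<in> syms b"
proof -
  show \<sigma>: "\<sigma> \<in> syms a" and \<epsilon>: "\<epsilon> \<in> P a \<rightarrow>\<^sub>E {1, -1}"
    using assms by (auto simp: weyl_elements_def signed_perms_def)
  show \<sigma>': "\<sigma> \<in> Bij (P a)" using \<sigma> by (rule syms_Bij)
  assume \<phi>: "\<phi> \<in> Hom C b a"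
  obtain \<psi> \<pi> where tw: "twists \<phi> \<psi> \<sigma> \<epsilon> \<pi> b a" using sym_perms_twists[OF \<sigma> \<phi>] .
  with sym_act_eq[OF \<sigma>' tw] weyl_perm_eq[OF \<sigma> \<epsilon> tw]
  show "twists \<phi> (sact \<sigma> \<phi>) \<sigma> \<epsilon> (wperm \<phi> (\<sigma>, \<epsilon>)) b a" by simp
  show "wperm \<phi> (\<sigma>, \<epsilon>) \<in> syms b"
    using assms \<phi> Hom_Obj[OF \<phi>] by (auto simp: weyl_elements_def)
qed

definition wmult :: "'o \<Rightarrow> ('m \<Rightarrow> 'm) \<times> ('m \<Rightarrow> int) \<Rightarrow> ('m \<Rightarrow> 'm) \<times> ('m \<Rightarrow> int) \<Rightarrow> ('m \<Rightarrow> 'm) \<times> ('m \<Rightarrow> int)"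
  where "wmult a w v = (compose (P a) (fst w) (fst v), \<lambda>i\<in>P a. snd w (fst v i) * snd v i)"

lemma weyl_simps:
  "carrier (grp W a) = Wel a"
  "w \<otimes>\<^bsub>grp W a\<^esub> v = wmult a w v"
  "\<one>\<^bsub>grp W a\<^esub> = (\<lambda>i\<in>P a. i, \<lambda>i\<in>P a. 1)"
  "restr W \<phi> w = (wperm \<phi> w, pull_signs C s \<phi> (snd w))"
  "act W w \<phi> = sact (fst w) \<phi>"
  by (simp_all add: weyl_def signed_perms_def wmult_def split_beta)

lemma wmult_twists:
  assumes "(\<tau>, \<zeta>) \<in> Wel a" "(\<sigma>, \<epsilon>) \<in> Wel a" and \<phi>: "\<phi> \<in> Hom C b a"
  shows "twists \<phi> (sact \<tau> (sact \<sigma> \<phi>)) (compose (P a) \<tau> \<sigma>) (\<lambda>i\<in>P a. \<zeta> (\<sigma> i) * \<epsilon> i)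
    (compose (P b) (wperm (sact \<sigma> \<phi>) (\<tau>, \<zeta>)) (wperm \<phi> (\<sigma>, \<epsilon>))) b a"
proof (rule twists_vertical)
  show tw: "twists \<phi> (sact \<sigma> \<phi>) \<sigma> \<epsilon> (wperm \<phi> (\<sigma>, \<epsilon>)) b a"
    using weyl_elementsD(4)[OF assms(2) \<phi>] .
  show "twists (sact \<sigma> \<phi>) (sact \<tau> (sact \<sigma> \<phi>)) \<tau> \<zeta> (wperm (sact \<sigma> \<phi>) (\<tau>, \<zeta>)) b a"
    using weyl_elementsD(4)[OF assms(1) twistsD(2)[OF tw]] .
qed (use weyl_elementsD(3)[OF assms(1)] weyl_elementsD(3)[OF assms(2)] in auto)

lemma wmult_closed:
  assumes w: "(\<tau>, \<zeta>) \<in> Wel a" and v: "(\<sigma>, \<epsilon>) \<in> Wel a"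
  shows "wmult a (\<tau>, \<zeta>) (\<sigma>, \<epsilon>) \<in> Wel a"
proof -
  note W = weyl_elementsD[OF w] and V = weyl_elementsD[OF v]
  have S: "compose (P a) \<tau> \<sigma> \<in> syms a" using W(1) V(1) by (rule compose_syms)
  have E: "(\<lambda>i\<in>P a. \<zeta> (\<sigma> i) * \<epsilon> i) \<in> P a \<rightarrow>\<^sub>E {1, -1}"
  proof (rule restrict_PiE_iff[THEN iffD2], rule ballI)
    fix i assume i: "i \<in> P a"
    have "\<zeta> (\<sigma> i) \<in> {1, -1}" "\<epsilon> i \<in> {1, -1}"
      using PiE_mem[OF W(3) Bij_apply[OF V(2) i]] PiE_mem[OF V(3) i] .
    then show "\<zeta> (\<sigma> i) * \<epsilon> i \<in> {1, -1}" by auto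
  qed
  have "\<exists>\<psi> \<pi>. twists \<phi> \<psi> (compose (P a) \<tau> \<sigma>) (\<lambda>i\<in>P a. \<zeta> (\<sigma> i) * \<epsilon> i) \<pi> b a \<and> \<pi> \<in> syms b"
    if \<phi>: "\<phi> \<in> Hom C b a" for b \<phi>
  proof (intro exI conjI)
    show "twists \<phi> (sact \<tau> (sact \<sigma> \<phi>)) (compose (P a) \<tau> \<sigma>) (\<lambda>i\<in>P a. \<zeta> (\<sigma> i) * \<epsilon> i)
      (compose (P b) (wperm (sact \<sigma> \<phi>) (\<tau>, \<zeta>)) (wperm \<phi> (\<sigma>, \<epsilon>))) b a"
      using wmult_twists[OF w v \<phi>] .
    show "compose (P b) (wperm (sact \<sigma> \<phi>) (\<tau>, \<zeta>)) (wperm \<phi> (\<sigma>, \<epsilon>)) \<in> syms b"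
      by (rule compose_syms[OF W(5)[OF twistsD(2)[OF V(4)[OF \<phi>]]] V(5)[OF \<phi>]])
  qed
  from weyl_elementsI[OF S E this] show ?thesis by (simp add: wmult_def)
qed

lemma one_Wel: "(\<lambda>i\<in>P a. i, \<lambda>i\<in>P a. 1) \<in> Wel a"
proof (rule weyl_elementsI[OF id_syms])
  fix b \<phi> assume \<phi>: "\<phi> \<in> Hom C b a"
  have "twists \<phi> \<phi> (\<lambda>i\<in>P a. i) (\<lambda>i\<in>P a. 1) (\<lambda>i\<in>P b. i) b a"
    by (rule twists_cong[OF twists_id[OF \<phi>]]) auto
  then show "\<exists>\<psi> \<pi>. twists \<phi> \<psi> (\<lambda>i\<in>P a. i) (\<lambda>i\<in>P a. 1) \<pi> b a \<and> \<pi> \<in> syms b"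
    using id_syms by blast
qed auto

text \<open>Every arrow is some \<open>sact \<sigma> \<phi>\<close>, so a square ending there is
  available for inversion.\<close>

lemma inverse_syms:
  assumes \<sigma>: "\<sigma> \<in> syms a" and \<tau>: "\<tau> \<in> Bij (P a)" "\<And>i. i \<in> P a \<Longrightarrow> \<tau> (\<sigma> i) = i"
  shows "\<tau> \<in> syms a"
proof (rule sym_permsI[OF \<tau>(1)])
  fix b \<psi> assume "\<psi> \<in> Hom C b a"
  then obtain \<phi> where \<phi>: "\<phi> \<in> Hom C b a" "\<psi> = sact \<sigma> \<phi>"
    using sym_act_bij[OF \<sigma>, of b] by (auto simp: bij_betw_def)
  obtain \<psi>' \<pi> where tw: "twists \<phi> \<psi>' \<sigma> (\<lambda>_. 1) \<pi> b a" using sym_perms_twists[OF \<sigma> \<phi>(1)] .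
  then have tw: "twists \<phi> \<psi> \<sigma> (\<lambda>_. 1) \<pi> b a" using sym_act_eq[OF syms_Bij[OF \<sigma>] tw] \<phi>(2) by simp
  obtain \<rho> where \<rho>: "\<rho> \<in> Bij (P b)" "\<And>x. x \<in> P b \<Longrightarrow> \<pi> (\<rho> x) = x"
    using Bij_inverseE[OF twistsD(3)[OF tw]] by metis
  from twistsD[OF twists_inverse[OF tw \<tau>(2) syms_Bij[OF \<sigma>] \<rho>]] \<rho>(1)
  show "\<exists>\<psi>'\<in>Hom C b a. \<exists>\<pi>\<in>Bij (P b). \<forall>\<alpha>\<in>P b. \<tau> (\<psi> \<cdot> \<alpha>) = \<psi>' \<cdot> \<pi> \<alpha>" by blast
qed

lemma wmult_inverse:
  assumes w: "(\<sigma>, \<epsilon>) \<in> Wel a"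
  shows "\<exists>v\<in>Wel a. wmult a v (\<sigma>, \<epsilon>) = (\<lambda>i\<in>P a. i, \<lambda>i\<in>P a. 1)"
proof -
  note W = weyl_elementsD[OF w]
  obtain \<tau> where \<tau>: "\<tau> \<in> Bij (P a)" "\<And>i. i \<in> P a \<Longrightarrow> \<tau> (\<sigma> i) = i"
    using Bij_inverseE[OF W(2)] by metis
  \<comment> \<open>Signs are their own inverses, so only their index is moved by
    \<open>\<tau>\<close>.\<close>
  have "(\<tau>, \<lambda>i\<in>P a. \<epsilon> (\<tau> i)) \<in> Wel a"
  proof (rule weyl_elementsI[OF inverse_syms[OF W(1) \<tau>]])
    show "(\<lambda>i\<in>P a. \<epsilon> (\<tau> i)) \<in> P a \<rightarrow>\<^sub>E {1, -1}"
      using PiE_mem[OF W(3) Bij_apply[OF \<tau>(1)]] by simp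
    fix b \<psi> assume "\<psi> \<in> Hom C b a"
    then obtain \<phi> where \<phi>: "\<phi> \<in> Hom C b a" "\<psi> = sact \<sigma> \<phi>"
      using sym_act_bij[OF W(1), of b] by (auto simp: bij_betw_def)
    have tw: "twists \<phi> \<psi> \<sigma> \<epsilon> (wperm \<phi> (\<sigma>, \<epsilon>)) b a" using W(4)[OF \<phi>(1)] \<phi>(2) by simp
    obtain \<rho> where \<rho>: "\<rho> \<in> Bij (P b)" "\<And>x. x \<in> P b \<Longrightarrow> \<rho> (wperm \<phi> (\<sigma>, \<epsilon>) x) = x"
      "\<And>x. x \<in> P b \<Longrightarrow> wperm \<phi> (\<sigma>, \<epsilon>) (\<rho> x) = x"
      using Bij_inverseE[OF twistsD(3)[OF tw]] by metis
    have "twists \<psi> \<phi> \<tau> (\<lambda>i\<in>P a. \<epsilon> (\<tau> i)) \<rho> b a"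
      by (rule twists_cong[OF twists_inverse[OF tw \<tau>(2) W(2) \<rho>(1,3)]]) auto
    moreover have "\<rho> \<in> syms b" using inverse_syms[OF W(5)[OF \<phi>(1)] \<rho>(1,2)] .
    ultimately show "\<exists>\<psi>' \<pi>. twists \<psi> \<psi>' \<tau> (\<lambda>i\<in>P a. \<epsilon> (\<tau> i)) \<pi> b a \<and> \<pi> \<in> syms b" by blast
  qed
  moreover have "wmult a (\<tau>, \<lambda>i\<in>P a. \<epsilon> (\<tau> i)) (\<sigma>, \<epsilon>) = (\<lambda>i\<in>P a. i, \<lambda>i\<in>P a. 1)"
  proof -
    have "compose (P a) \<tau> \<sigma> = (\<lambda>i\<in>P a. i)"
      unfolding compose_def by (rule restrict_ext) (rule \<tau>(2))
    moreover have "(\<lambda>i\<in>P a. (\<lambda>i\<in>P a. \<epsilon> (\<tau> i)) (\<sigma> i) * \<epsilon> i) = (\<lambda>i\<in>P a. 1)"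
    proof (rule restrict_ext)
      fix i assume i: "i \<in> P a"
      show "(\<lambda>i\<in>P a. \<epsilon> (\<tau> i)) (\<sigma> i) * \<epsilon> i = 1"
        using i \<tau>(2)[OF i] Bij_apply[OF W(2) i] PiE_mem[OF W(3) i] by auto
    qed
    ultimately show ?thesis by (simp add: wmult_def)
  qed
  ultimately show ?thesis by blast
qed

lemma weyl_group: "group (grp W a)"
proof (rule groupI; unfold weyl_simps)
  show "wmult a x y \<in> Wel a" if "x \<in> Wel a" "y \<in> Wel a" for x y
    using that wmult_closed by (cases x; cases y) simp
  show "(\<lambda>i\<in>P a. i, \<lambda>i\<in>P a. 1) \<in> Wel a" by (rule one_Wel)
  show "wmult a (wmult a x y) z = wmult a x (wmult a y z)"
    if "x \<in> Wel a" "y \<in> Wel a" "z \<in> Wel a" for x y z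
  proof -
    have z: "fst z i \<in> P a" if "i \<in> P a" for i
      using Bij_apply[OF weyl_elementsD(2)[of "fst z" "snd z" a] that] \<open>z \<in> Wel a\<close> by simp
    have y: "fst y i \<in> P a" if "i \<in> P a" for i
      using Bij_apply[OF weyl_elementsD(2)[of "fst y" "snd y" a] that] \<open>y \<in> Wel a\<close> by simp
    show ?thesis
      by (auto simp: wmult_def compose_def z y mult.assoc intro!: restrict_ext)
  qed
  show "wmult a (\<lambda>i\<in>P a. i, \<lambda>i\<in>P a. 1) x = x" if "x \<in> Wel a" for x
  proof -
    obtain \<sigma> \<epsilon> where x: "x = (\<sigma>, \<epsilon>)" by (cases x)
    note W = weyl_elementsD[OF that[unfolded x]]
    have "compose (P a) (\<lambda>i\<in>P a. i) \<sigma> = \<sigma>"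
      using Bij_imp_funcset[OF W(2)] Bij_imp_extensional[OF W(2)] by (rule Id_compose)
    moreover have "(\<lambda>i\<in>P a. (\<lambda>i\<in>P a. 1) (\<sigma> i) * \<epsilon> i) = \<epsilon>"
      by (rule extensionalityI[of _ "P a"]) (use W(3) Bij_apply[OF W(2)] in \<open>auto simp: PiE_def\<close>)
    ultimately show ?thesis by (simp add: x wmult_def)
  qed
  show "\<exists>y\<in>Wel a. wmult a y x = (\<lambda>i\<in>P a. i, \<lambda>i\<in>P a. 1)" if "x \<in> Wel a" for x
    using that wmult_inverse by (cases x) simp
qed

lemma sym_act_compose:
  assumes "(\<tau>, \<zeta>) \<in> Wel a" "(\<sigma>, \<epsilon>) \<in> Wel a" "\<phi> \<in> Hom C b a"
  shows "sact (compose (P a) \<tau> \<sigma>) \<phi> = sact \<tau> (sact \<sigma> \<phi>)"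
  by (rule sym_act_eq[OF compose_Bij wmult_twists[OF assms]])
    (use weyl_elementsD(2)[OF assms(1)] weyl_elementsD(2)[OF assms(2)] in auto)

text \<open>By horizontal pasting the permutation of the restricted pair over \<open>\<chi>\<close>
  is that of the original pair over \<open>\<phi> \<cdot> \<chi>\<close>, which is admissible by
  assumption.\<close>

lemma weyl_restr_closed:
  assumes w: "(\<sigma>, \<epsilon>) \<in> Wel a" and \<phi>: "\<phi> \<in> Hom C b a"
  shows "(wperm \<phi> (\<sigma>, \<epsilon>), \<lambda>j\<in>P b. \<epsilon> (\<phi> \<cdot> j)) \<in> Wel b"
proof (rule weyl_elementsI)
  note W = weyl_elementsD[OF w]
  show S: "wperm \<phi> (\<sigma>, \<epsilon>) \<in> syms b" using W(5)[OF \<phi>] .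
  show "(\<lambda>j\<in>P b. \<epsilon> (\<phi> \<cdot> j)) \<in> P b \<rightarrow>\<^sub>E {1, -1}"
    using PiE_mem[OF W(3) comp_P[OF \<phi>]] by simp
  fix c \<chi> assume \<chi>: "\<chi> \<in> Hom C c b"
  obtain \<omega> \<rho> where tw: "twists \<chi> \<omega> (wperm \<phi> (\<sigma>, \<epsilon>)) (\<lambda>j\<in>P b. \<epsilon> (\<phi> \<cdot> j)) \<rho> c b"
    using sym_perms_twists[OF S \<chi>] .
  have "wperm (\<phi> \<cdot> \<chi>) (\<sigma>, \<epsilon>) = \<rho>"
    by (rule weyl_perm_eq[OF W(1,3) twists_horizontal[OF W(4)[OF \<phi>] tw]])
  with W(5)[OF Comp_in_Hom[OF \<chi> \<phi>]] tw
  show "\<exists>\<psi> \<pi>. twists \<chi> \<psi> (wperm \<phi> (\<sigma>, \<epsilon>)) (\<lambda>j\<in>P b. \<epsilon> (\<phi> \<cdot> j)) \<pi> c b \<and> \<pi> \<in> syms c" by auto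
qed

lemma pull_signs_eq: "\<phi> \<in> Hom C b a \<Longrightarrow> pull_signs C s \<phi> \<epsilon> = (\<lambda>j\<in>P b. \<epsilon> (\<phi> \<cdot> j))"
  by (auto simp: pull_signs_def Hom_D push_apply intro!: restrict_ext)

text \<open>One pasted square read twice: its arrow gives axiom (i), its permutation the
  functoriality of restriction.\<close>

lemma weyl_horizontal:
  assumes w: "(\<sigma>, \<epsilon>) \<in> Wel a" and \<phi>: "\<phi> \<in> Hom C b a" and \<chi>: "\<chi> \<in> Hom C c b"
  shows "sact \<sigma> (\<phi> \<cdot> \<chi>) = sact \<sigma> \<phi> \<cdot> sact (wperm \<phi> (\<sigma>, \<epsilon>)) \<chi>"
    "wperm (\<phi> \<cdot> \<chi>) (\<sigma>, \<epsilon>) = wperm \<chi> (wperm \<phi> (\<sigma>, \<epsilon>), \<lambda>j\<in>P b. \<epsilon> (\<phi> \<cdot> j))"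
proof -
  note W = weyl_elementsD[OF w]
  note tw = twists_horizontal[OF W(4)[OF \<phi>] weyl_elementsD(4)[OF weyl_restr_closed[OF w \<phi>] \<chi>]]
  show "sact \<sigma> (\<phi> \<cdot> \<chi>) = sact \<sigma> \<phi> \<cdot> sact (wperm \<phi> (\<sigma>, \<epsilon>)) \<chi>"
    by (rule sym_act_eq[OF W(2) tw])
  show "wperm (\<phi> \<cdot> \<chi>) (\<sigma>, \<epsilon>) = wperm \<chi> (wperm \<phi> (\<sigma>, \<epsilon>), \<lambda>j\<in>P b. \<epsilon> (\<phi> \<cdot> j))"
    by (rule weyl_perm_eq[OF W(1,3) tw])
qed

lemma weyl_action:
  "group_action (grp W a) (Hom C b a) (\<lambda>x. restrict (act W x) (Hom C b a))"
proof -
  have bij: "restrict (sact (fst w)) (Hom C b a) \<in> Bij (Hom C b a)" if "w \<in> Wel a" for w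
    using sym_act_bij[of "fst w" a b] weyl_elementsD(1)[of "fst w" "snd w" a] that by (simp add: Bij_def)
  have "(\<lambda>x. restrict (act W x) (Hom C b a)) \<in> hom (grp W a) (BijGroup (Hom C b a))"
  proof (rule homI; unfold weyl_simps)
    show "restrict (sact (fst w)) (Hom C b a) \<in> carrier (BijGroup (Hom C b a))" if "w \<in> Wel a" for w
      using bij[OF that] by (simp add: BijGroup_def)
    fix w v assume wv: "w \<in> Wel a" "v \<in> Wel a"
    have "restrict (sact (fst (wmult a w v))) (Hom C b a)
      = compose (Hom C b a) (restrict (sact (fst w)) (Hom C b a)) (restrict (sact (fst v)) (Hom C b a))"
      unfolding compose_def
    proof (rule restrict_ext)
      fix \<phi> assume \<phi>: "\<phi> \<in> Hom C b a"
      have "sact (fst v) \<phi> \<in> Hom C b a" using Bij_apply[OF bij[OF wv(2)] \<phi>] \<phi> by simp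
      then show "sact (fst (wmult a w v)) \<phi> =
        restrict (sact (fst w)) (Hom C b a) (restrict (sact (fst v)) (Hom C b a) \<phi>)"
        using sym_act_compose[of "fst w" "snd w" a "fst v" "snd v" \<phi> b] wv \<phi> by (simp add: wmult_def)
    qed
    then show "restrict (sact (fst (wmult a w v))) (Hom C b a) =
      restrict (sact (fst w)) (Hom C b a) \<otimes>\<^bsub>BijGroup (Hom C b a)\<^esub> restrict (sact (fst v)) (Hom C b a)"
      using bij[OF wv(1)] bij[OF wv(2)] by (simp add: BijGroup_def)
  qed
  then show ?thesis
    by (simp add: group_action_def group_hom_def group_hom_axioms_def weyl_group group_BijGroup)
qed

lemma weyl_crossed_group: "crossed_group C W"
proof (rule crossed_group.intro[OF small_category_axioms crossed_group_axioms.intro])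
  show "group (grp W a)" for a by (rule weyl_group)
  show "group_action (grp W b) (Hom C a b) (\<lambda>x. restrict (act W x) (Hom C a b))" for a b
    by (rule weyl_action)
  show "restr W \<phi> x \<in> carrier (grp W a)" if \<phi>: "\<phi> \<in> Hom C a b" and x: "x \<in> carrier (grp W b)" for \<phi> a b x
  proof -
    obtain \<sigma> \<epsilon> where w: "x = (\<sigma>, \<epsilon>)" by (cases x)
    with weyl_restr_closed[of \<sigma> \<epsilon> b \<phi> a] x \<phi> show ?thesis by (simp add: weyl_simps pull_signs_eq[OF \<phi>])
  qed
  show "restr W (Ident C a) x = x" if a: "a \<in> Obj C" and x: "x \<in> carrier (grp W a)" for a x
  proof -
    obtain \<sigma> \<epsilon> where w: "x = (\<sigma>, \<epsilon>)" by (cases x)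
    have x: "(\<sigma>, \<epsilon>) \<in> Wel a" using x w by (simp add: weyl_simps)
    note W = weyl_elementsD[OF x]
    have "wperm (Ident C a) (\<sigma>, \<epsilon>) = \<sigma>"
      by (rule weyl_perm_eq[OF W(1,3) twists_Ident[OF a W(2)]])
    moreover have "(\<lambda>j\<in>P a. \<epsilon> (Ident C a \<cdot> j)) = \<epsilon>"
      by (rule extensionalityI[of _ "P a"]) (use W(3) in \<open>auto simp: PiE_def Comp_Ident_left\<close>)
    ultimately show ?thesis by (simp add: w weyl_simps pull_signs_eq[OF Ident_in_Hom[OF a]])
  qed
  fix \<phi> a b x assume \<phi>: "\<phi> \<in> Hom C a b"
  show "restr W (\<psi> \<cdot> \<phi>) x = restr W \<phi> (restr W \<psi> x)"
    and "act W x (\<psi> \<cdot> \<phi>) = act W x \<psi> \<cdot> act W (restr W \<psi> x) \<phi>"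
    if \<psi>: "\<psi> \<in> Hom C b c" and x: "x \<in> carrier (grp W c)" for \<psi> c
  proof -
    obtain \<sigma> \<epsilon> where w: "x = (\<sigma>, \<epsilon>)" by (cases x)
    have x: "(\<sigma>, \<epsilon>) \<in> Wel c" using x w by (simp add: weyl_simps)
    have "(\<lambda>j\<in>P a. \<epsilon> ((\<psi> \<cdot> \<phi>) \<cdot> j)) = (\<lambda>j\<in>P a. (\<lambda>j\<in>P b. \<epsilon> (\<psi> \<cdot> j)) (\<phi> \<cdot> j))"
      by (rule restrict_ext) (simp add: comp_P[OF \<phi>] Comp_assoc[OF _ \<phi> \<psi>])
    with weyl_horizontal[OF x \<psi> \<phi>] show "restr W (\<psi> \<cdot> \<phi>) x = restr W \<phi> (restr W \<psi> x)"
      "act W x (\<psi> \<cdot> \<phi>) = act W x \<psi> \<cdot> act W (restr W \<psi> x) \<phi>"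
      by (simp_all add: w weyl_simps pull_signs_eq[OF \<psi>] pull_signs_eq[OF \<phi>] pull_signs_eq[OF Comp_in_Hom[OF \<phi> \<psi>]])
  qed
  show "restr W \<phi> (x \<otimes>\<^bsub>grp W b\<^esub> y) = restr W (act W y \<phi>) x \<otimes>\<^bsub>grp W a\<^esub> restr W \<phi> y"
    if x: "x \<in> carrier (grp W b)" and y: "y \<in> carrier (grp W b)" for y
  proof -
    obtain \<tau> \<zeta> \<sigma> \<epsilon> where w: "x = (\<tau>, \<zeta>)" "y = (\<sigma>, \<epsilon>)" by (cases x; cases y)
    have x: "(\<tau>, \<zeta>) \<in> Wel b" and y: "(\<sigma>, \<epsilon>) \<in> Wel b" using x y w by (simp_all add: weyl_simps)
    note V = weyl_elementsD[OF y] and XY = weyl_elementsD[OF wmult_closed[OF x y, unfolded wmult_def fst_conv snd_conv]]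
    note tw = V(4)[OF \<phi>]
    \<comment> \<open>Axiom (ii) on permutations is the vertical pasting law.\<close>
    have perm: "wperm \<phi> (compose (P b) \<tau> \<sigma>, \<lambda>i\<in>P b. \<zeta> (\<sigma> i) * \<epsilon> i)
        = compose (P a) (wperm (sact \<sigma> \<phi>) (\<tau>, \<zeta>)) (wperm \<phi> (\<sigma>, \<epsilon>))"
      by (rule weyl_perm_eq[OF XY(1,3) wmult_twists[OF x y \<phi>]])
    \<comment> \<open>The indices of \<open>\<zeta>\<close> match by commutation of the square:
      \<open>\<sigma> (\<phi> \<cdot> j)\<close> is \<open>sact \<sigma> \<phi>\<close> composed
      with \<open>wperm \<phi> (\<sigma>, \<epsilon>) j\<close>.\<close>
    have "(\<lambda>j\<in>P a. (\<lambda>i\<in>P b. \<zeta> (\<sigma> i) * \<epsilon> i) (\<phi> \<cdot> j)) =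
      (\<lambda>i\<in>P a. (\<lambda>j\<in>P a. \<zeta> (sact \<sigma> \<phi> \<cdot> j)) (wperm \<phi> (\<sigma>, \<epsilon>) i) * (\<lambda>j\<in>P a. \<epsilon> (\<phi> \<cdot> j)) i)"
      by (rule restrict_ext) (simp add: comp_P[OF \<phi>] twistsD(4)[OF tw] Bij_apply[OF twistsD(3)[OF tw]])
    with perm show ?thesis
      by (simp add: w weyl_simps wmult_def pull_signs_eq[OF \<phi>] pull_signs_eq[OF twistsD(2)[OF tw]])
  qed
qed

section \<open>Arrows out of the generator\<close>

text \<open>The comparisons of \<open>\<iota>\<^sub>0 \<cdot> m\<close> with \<open>\<iota>\<^sub>1\<close> and of \<open>\<iota>\<^sub>0\<close> with \<open>\<iota>\<^sub>1 \<cdot> m\<close> in \<open>P sbar\<close> are universal: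
  pushed forward along \<open>sbar \<rightarrow> a\<close> they become statements about all pairs \<open>p \<le> q\<close> in \<open>P a\<close>.\<close>

lemma endo_top_or_bot:
  assumes m: "m \<in> P s" "m \<noteq> Ident C s"
  shows "(\<forall>a. \<forall>p\<in>P a. \<forall>q\<in>P a. lea a q (p \<cdot> m)) \<or> (\<forall>a. \<forall>p\<in>P a. \<forall>q\<in>P a. lea a (p \<cdot> m) q)"
proof -
  note trans = finite_chain.trans[OF chain]
  have im: "\<iota>\<^sub>0 \<cdot> m \<in> P sbar" "\<iota>\<^sub>1 \<cdot> m \<in> P sbar" using \<iota>_Hom m comp_P by blast+
  have pm: "p \<cdot> m \<in> P a" if "p \<in> P a" for p a using that m comp_P by blast
  have univ: "\<exists>f\<in>Hom C sbar a. p = f \<cdot> \<iota>\<^sub>0 \<and> q = f \<cdot> \<iota>\<^sub>1 \<and> p \<cdot> m = f \<cdot> (\<iota>\<^sub>0 \<cdot> m) \<and> q \<cdot> m = f \<cdot> (\<iota>\<^sub>1 \<cdot> m)"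
    if pq: "lea a p q" for a p q
  proof -
    obtain f where f: "f \<in> Hom C sbar a" "f \<cdot> \<iota>\<^sub>0 = p" "f \<cdot> \<iota>\<^sub>1 = q" using pq by (auto simp: le_def)
    then show ?thesis
      using Comp_assoc[OF m(1) \<iota>_Hom(1) f(1)] Comp_assoc[OF m(1) \<iota>_Hom(2) f(1)] by auto
  qed
  have push0: "lea a (p \<cdot> m) q" if "lea sbar (\<iota>\<^sub>0 \<cdot> m) \<iota>\<^sub>1" "lea a p q" for a p q
    using univ[OF that(2)] comp_monotone[OF _ that(1)] by auto
  have push0': "lea a q (p \<cdot> m)" if "lea sbar \<iota>\<^sub>1 (\<iota>\<^sub>0 \<cdot> m)" "lea a p q" for a p q
    using univ[OF that(2)] comp_monotone[OF _ that(1)] by auto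
  have push1: "lea a p (q \<cdot> m)" if "lea sbar \<iota>\<^sub>0 (\<iota>\<^sub>1 \<cdot> m)" "lea a p q" for a p q
    using univ[OF that(2)] comp_monotone[OF _ that(1)] by auto
  have push1': "lea a (q \<cdot> m) p" if "lea sbar (\<iota>\<^sub>1 \<cdot> m) \<iota>\<^sub>0" "lea a p q" for a p q
    using univ[OF that(2)] comp_monotone[OF _ that(1)] by auto
  \<comment> \<open>The first case makes every \<open>p \<cdot> m\<close> greatest and the second
    makes it least; a \<open>q\<close> on the other side of \<open>p\<close> is reached by
    transitivity through \<open>p\<close>.\<close>
  consider "lea sbar \<iota>\<^sub>1 (\<iota>\<^sub>0 \<cdot> m)" | "lea sbar (\<iota>\<^sub>1 \<cdot> m) \<iota>\<^sub>0" | "lea sbar (\<iota>\<^sub>0 \<cdot> m) \<iota>\<^sub>1" "lea sbar \<iota>\<^sub>0 (\<iota>\<^sub>1 \<cdot> m)"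
    using le_total \<iota>_Hom im by blast
  then show ?thesis
  proof cases
    case 1
    have "lea a q (p \<cdot> m)" if "p \<in> P a" "q \<in> P a" for a p q
    proof (cases "lea a p q")
      case False
      then have "lea a q p" using le_total that by blast
      then show ?thesis
        using trans[OF Hom_Obj(2)[OF that(1)] that(2,1) pm[OF that(1)] _ push0'[OF 1 le_refl[OF that(1)]]] by blast
    qed (rule push0'[OF 1])
    then show ?thesis by blast
  next
    case 2
    have "lea a (p \<cdot> m) q" if "p \<in> P a" "q \<in> P a" for a p q
    proof (cases "lea a q p")
      case False
      then have "lea a p q" using le_total that by blast
      then show ?thesis
        using trans[OF Hom_Obj(2)[OF that(1)] pm[OF that(1)] that(1,2) push1'[OF 2 le_refl[OF that(1)]]] by blast
    qed (rule push1'[OF 2])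
    then show ?thesis by blast
  next
    case 3
    \<comment> \<open>Here \<open>m\<close> would be squeezed between the identity and itself,
      against \<open>m \<noteq> Ident C s\<close>.\<close>
    have e: "Ident C s \<in> P s" using Ident_in_Hom s_Obj by blast
    have "Ident C s \<cdot> m = Ident C s"
      using le_antisym[OF pm[OF e] e] push0[OF 3(1) le_refl[OF e]] push1[OF 3(2) le_refl[OF e]] by blast
    then show ?thesis using m Comp_Ident_left by simp
  qed
qed

lemma endo_const:
  assumes m: "m \<in> P s" "m \<noteq> Ident C s" and pq: "p \<in> P a" "q \<in> P a"
  shows "p \<cdot> m = q \<cdot> m"
proof -
  have pm: "p \<cdot> m \<in> P a" "q \<cdot> m \<in> P a" using pq m comp_P by blast+
  from endo_top_or_bot[OF m] have "lea a (p \<cdot> m) (q \<cdot> m) \<and> lea a (q \<cdot> m) (p \<cdot> m)"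
    using pq pm by blast
  then show ?thesis using le_antisym[OF pm] by blast
qed

text \<open>The value \<open>\<phi>\<close> is taken at least twice by \<open>push \<phi>\<close>, so \<open>\<tau> \<phi>\<close> is taken at least twice by
  \<open>push (sact \<tau> \<phi>)\<close>: at the identity, or at both the least and the greatest endomorphism of \<open>s\<close>.\<close>

lemma sym_act_const:
  assumes tw: "twists \<phi> \<psi> \<tau> \<epsilon> \<pi> s a" and \<tau>: "\<tau> \<in> Bij (P a)"
    and m: "m \<in> P s" "m \<noteq> Ident C s" and p: "p \<in> P a" "\<phi> = p \<cdot> m"
  shows "\<psi> = \<tau> \<phi>"
proof -
  note D = twistsD[OF tw]
  have e: "Ident C s \<in> P s" using Ident_in_Hom s_Obj by blast
  let ?u = "\<pi> (Ident C s)" and ?v = "\<pi> m"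
  have uv: "?u \<in> P s" "?v \<in> P s" "?u \<noteq> ?v"
    using Bij_apply[OF D(3)] e m Bij_eqD[OF D(3) e m(1)] by auto
  \<comment> \<open>\<open>\<phi>\<close> is the constant value of precomposition with
    \<open>m\<close>, so the square takes the value \<open>\<tau> \<phi>\<close> at the two distinct
    places \<open>?u\<close> and \<open>?v\<close>.\<close>
  have "\<phi> \<cdot> m = \<phi>" using endo_const[OF m D(1) p(1)] p(2) by simp
  then have val: "\<tau> \<phi> = \<psi> \<cdot> ?u" "\<tau> \<phi> = \<psi> \<cdot> ?v"
    using D(4)[OF e] D(4)[OF m(1)] Comp_Ident_right[OF D(1)] by auto
  show ?thesis
  proof (cases "?u = Ident C s \<or> ?v = Ident C s")
    case True
    then show ?thesis using val Comp_Ident_right[OF D(2)] by metis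
  next
    case False
    let ?top = "\<lambda>m. \<forall>a. \<forall>p\<in>P a. \<forall>q\<in>P a. lea a q (p \<cdot> m)"
    let ?bot = "\<lambda>m. \<forall>a. \<forall>p\<in>P a. \<forall>q\<in>P a. lea a (p \<cdot> m) q"
    have tb: "?top ?u \<or> ?bot ?u" "?top ?v \<or> ?bot ?v"
      using endo_top_or_bot uv False by blast+
    \<comment> \<open>Evaluated at the identity, each property singles out one element of
      \<open>P s\<close>, so the distinct \<open>?u\<close> and \<open>?v\<close> have opposite
      types and \<open>\<tau> \<phi>\<close> is both greatest and least in
      \<open>P a\<close>.\<close>
    have "\<not> (?top ?u \<and> ?top ?v)" "\<not> (?bot ?u \<and> ?bot ?v)"
      using le_antisym[OF uv(1,2)] uv e Comp_Ident_left[OF uv(1)] Comp_Ident_left[OF uv(2)] by metis+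
    with tb have "(?top ?u \<and> ?bot ?v) \<or> (?bot ?u \<and> ?top ?v)" by blast
    then have "lea a \<psi> (\<tau> \<phi>) \<and> lea a (\<tau> \<phi>) \<psi>"
      using val D(2) by metis
    then show ?thesis using le_antisym D(2) Bij_apply[OF \<tau> D(1)] by blast
  qed
qed

text \<open>At the identity the square gives \<open>\<tau> \<phi> = \<psi> \<cdot> u\<close>, where
  \<open>u\<close> is the image of the identity. If \<open>u\<close> is another endomorphism, then
  \<open>\<phi>\<close> turns out to have the form \<open>p \<cdot> m\<close> with \<open>m\<close>
  not the identity, and \<open>sym_act_const\<close> applies.\<close>

lemma sym_act_generator:
  assumes \<tau>: "\<tau> \<in> syms a" and \<phi>: "\<phi> \<in> P a"
  shows "sact \<tau> \<phi> = \<tau> \<phi>"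
proof -
  have \<tau>': "\<tau> \<in> Bij (P a)" using \<tau> by (rule syms_Bij)
  have e: "Ident C s \<in> P s" using Ident_in_Hom s_Obj by blast
  obtain \<psi> \<pi> where tw: "twists \<phi> \<psi> \<tau> (\<lambda>_. 1) \<pi> s a" using sym_perms_twists[OF \<tau> \<phi>] .
  note D = twistsD[OF tw]
  let ?u = "\<pi> (Ident C s)"
  have u: "?u \<in> P s" using Bij_apply[OF D(3) e] .
  have val: "\<tau> \<phi> = \<psi> \<cdot> ?u" using D(4)[OF e] Comp_Ident_right[OF \<phi>] by simp
  have "\<psi> = \<tau> \<phi>"
  proof (cases "?u = Ident C s")
    case True
    then show ?thesis using val Comp_Ident_right[OF D(2)] by simp
  next
    case False
    define k where "k = \<psi> \<cdot> ?u"
    have k: "k \<in> P a" using comp_P[OF D(2) u] by (simp add: k_def)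
    obtain \<psi>' \<pi>' where tw': "twists k \<psi>' \<tau> (\<lambda>_. 1) \<pi>' s a" using sym_perms_twists[OF \<tau> k] .
    note D' = twistsD[OF tw']
    \<comment> \<open>With \<open>n\<close> chosen to land on \<open>?u\<close>, constancy gives
      \<open>\<tau> (k \<cdot> n) = k = \<tau> \<phi>\<close>, whatever the arrow
      \<open>\<psi>'\<close> is.\<close>
    obtain n where n: "n \<in> P s" "\<pi>' n = ?u" using Bij_inverseE[OF D'(3)] u Bij_apply by metis
    have "\<tau> (k \<cdot> n) = k"
      using D'(4)[OF n(1)] n(2) endo_const[OF u False D'(2) D(2)] by (simp add: k_def)
    then have \<phi>k: "\<phi> = k \<cdot> n"
      using Bij_eqD[OF \<tau>' \<phi> comp_P[OF k n(1)]] val k_def by simp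
    show ?thesis
    proof (cases "n = Ident C s")
      case True
      then have "\<phi> = \<psi> \<cdot> ?u" using \<phi>k Comp_Ident_right[OF k] k_def by simp
      then show ?thesis by (rule sym_act_const[OF tw \<tau>' u False D(2)])
    next
      case False
      show ?thesis by (rule sym_act_const[OF tw \<tau>' n(1) False k \<phi>k])
    qed
  qed
  then show ?thesis using sym_act_eq[OF \<tau>' tw] by simp
qed

section \<open>Signs\<close>

text \<open>The arrow \<open>sbar \<rightarrow> a\<close> that witnesses \<open>i \<le> i\<close>.\<close>

definition degen :: "'m \<Rightarrow> 'm" where
  "degen i = (SOME f. f \<in> Hom C sbar (Cod C i) \<and> f \<cdot> \<iota>\<^sub>0 = i \<and> f \<cdot> \<iota>\<^sub>1 = i)"

lemma degen:
  assumes "i \<in> P a"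
  shows "degen i \<in> Hom C sbar a" "degen i \<cdot> \<iota>\<^sub>0 = i" "degen i \<cdot> \<iota>\<^sub>1 = i"
proof -
  have "\<exists>f. f \<in> Hom C sbar a \<and> f \<cdot> \<iota>\<^sub>0 = i \<and> f \<cdot> \<iota>\<^sub>1 = i"
    using le_refl[OF assms] by (auto simp: le_def)
  from someI_ex[OF this] show "degen i \<in> Hom C sbar a" "degen i \<cdot> \<iota>\<^sub>0 = i" "degen i \<cdot> \<iota>\<^sub>1 = i"
    using Hom_D[OF assms] by (auto simp: degen_def)
qed

lemma degen_unique:
  assumes "f \<in> Hom C sbar a" "f \<cdot> \<iota>\<^sub>0 = i" "f \<cdot> \<iota>\<^sub>1 = i"
  shows "f = degen i"
proof -
  have "i \<in> P a" using comp_P[OF assms(1) \<iota>_Hom(1)] assms(2) by simp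
  note d = degen[OF this]
  show ?thesis by (rule jointly_epi[OF assms(1) d(1)]) (simp_all add: assms d)
qed

lemma degen_comp:
  assumes \<phi>: "\<phi> \<in> Hom C b a" and j: "j \<in> P b" shows "degen (\<phi> \<cdot> j) = \<phi> \<cdot> degen j"
proof -
  note d = degen[OF j]
  show ?thesis
    by (rule degen_unique[OF Comp_in_Hom[OF d(1) \<phi>], symmetric])
      (simp_all add: Comp_assoc[OF \<iota>_Hom(1) d(1) \<phi>] Comp_assoc[OF \<iota>_Hom(2) d(1) \<phi>] d)
qed

text \<open>The points \<open>\<iota>\<^sub>0 \<le> \<iota>\<^sub>1\<close> both lie in the fibre of
  \<open>degen i\<close> over \<open>i\<close>, so \<open>\<pi>\<close> orients them by
  \<open>\<epsilon> i\<close>; their images are distinct, so only one orientation can hold.\<close>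

lemma sign_eq_1_iff:
  assumes i: "i \<in> P a" and tw: "twists (degen i) \<psi> \<sigma> \<epsilon> \<pi> sbar a"
  shows "\<epsilon> i = 1 \<longleftrightarrow> lea sbar (\<pi> \<iota>\<^sub>0) (\<pi> \<iota>\<^sub>1)"
proof -
  note D = twistsD[OF tw] and d = degen[OF i]
  have "lea sbar \<iota>\<^sub>0 \<iota>\<^sub>1"
    unfolding le_def using Ident_in_Hom[OF sbar_Obj] \<iota>_Hom Comp_Ident_left by blast
  note F = D(5,6)[OF \<iota>_Hom _ this, unfolded d, OF refl]
  have \<pi>\<iota>: "\<pi> \<iota>\<^sub>0 \<in> P sbar" "\<pi> \<iota>\<^sub>1 \<in> P sbar" using \<iota>_Hom Bij_apply[OF D(3)] by auto
  have "\<pi> \<iota>\<^sub>0 \<noteq> \<pi> \<iota>\<^sub>1" using Bij_eqD[OF D(3) \<iota>_Hom] neq by blast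
  then show ?thesis using F le_antisym[OF \<pi>\<iota>] by blast
qed

end

section \<open>Terminality\<close>

locale co_ordered_crossed_group = co_ordered_category C s sbar \<iota>\<^sub>0 \<iota>\<^sub>1 + crossed_group C G
  for C :: "('o, 'm) category" (structure) and s sbar \<iota>\<^sub>0 \<iota>\<^sub>1
    and G :: "('o, 'm, 'g) crossed_group_data"
begin

section \<open>The permutation and the signs of an element of a crossed group\<close>

lemma act_Bij:
  assumes "x \<in> carrier (grp G a)" "a \<in> Obj C" "b \<in> Obj C"
  shows "restrict (act G x) (Hom C b a) \<in> Bij (Hom C b a)"
  using group_action.bij_prop0[OF action[OF assms(3,2)] assms(1)] .

lemma act_closed:
  assumes "x \<in> carrier (grp G a)" "\<phi> \<in> Hom C b a" shows "act G x \<phi> \<in> Hom C b a"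
  using Bij_apply[OF act_Bij[OF assms(1) Hom_Obj(2,1)[OF assms(2)]] assms(2)] assms(2) by simp

lemma act_mult:
  assumes "x \<in> carrier (grp G a)" "y \<in> carrier (grp G a)" "\<phi> \<in> Hom C b a"
  shows "act G (x \<otimes>\<^bsub>grp G a\<^esub> y) \<phi> = act G x (act G y \<phi>)"
  using group_action.composition_rule[OF action[OF Hom_Obj[OF assms(3)]] assms(3,1,2)] assms(3) act_closed[OF assms(2,3)]
  by simp

definition perm :: "'o \<Rightarrow> 'g \<Rightarrow> 'm \<Rightarrow> 'm" where
  "perm a x = restrict (act G x) (P a)"

text \<open>This is the only possible choice: by \<open>sign_eq_1_iff\<close> a sign is determined
  by the permutation over \<open>degen i\<close>.\<close>

definition sign :: "'o \<Rightarrow> 'g \<Rightarrow> 'm \<Rightarrow> int" where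
  "sign a x = (\<lambda>i\<in>P a. let y = restr G (degen i) x in
     if lea sbar (act G y \<iota>\<^sub>0) (act G y \<iota>\<^sub>1) then 1 else -1)"

lemma perm_Bij: "\<lbrakk>a \<in> Obj C; x \<in> carrier (grp G a)\<rbrakk> \<Longrightarrow> perm a x \<in> Bij (P a)"
  unfolding perm_def using act_Bij s_Obj by blast

lemma sign_mem: "sign a x \<in> P a \<rightarrow>\<^sub>E {1, -1}"
  by (auto simp: sign_def Let_def)

text \<open>Commutation is axiom (i) at arrows out of \<open>s\<close>; orientation is decided on
  the universal pair in \<open>P sbar\<close>.\<close>

lemma act_twists:
  assumes x: "x \<in> carrier (grp G a)" and \<phi>: "\<phi> \<in> Hom C b a"
  shows "twists \<phi> (act G x \<phi>) (perm a x) (sign a x) (perm b (restr G \<phi> x)) b a"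
proof -
  let ?z = "restr G \<phi> x"
  have z: "?z \<in> carrier (grp G b)" using restr_closed[OF \<phi> x] .
  \<comment> \<open>Axiom (i) at the arrow \<open>f\<close> witnessing
    \<open>\<alpha> \<le> \<beta>\<close> splits off the common factor \<open>act G ?z f\<close>,
    which is monotone. The other factor depends only on the index, as
    \<open>\<phi> \<cdot> f\<close> is degenerate.\<close>
  have fib: "\<exists>f y. f \<in> Hom C sbar b \<and> y = restr G (degen (\<phi> \<cdot> \<beta>)) x \<and> y \<in> carrier (grp G sbar) \<and>
      perm b ?z \<alpha> = act G ?z f \<cdot> act G y \<iota>\<^sub>0 \<and> perm b ?z \<beta> = act G ?z f \<cdot> act G y \<iota>\<^sub>1"
    if ab: "\<alpha> \<in> P b" "\<beta> \<in> P b" "\<phi> \<cdot> \<alpha> = \<phi> \<cdot> \<beta>" "lea b \<alpha> \<beta>" for \<alpha> \<beta>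
  proof -
    obtain f where f: "f \<in> Hom C sbar b" "f \<cdot> \<iota>\<^sub>0 = \<alpha>" "f \<cdot> \<iota>\<^sub>1 = \<beta>" using ab(4) by (auto simp: le_def)
    have "\<phi> \<cdot> f = degen (\<phi> \<cdot> \<beta>)"
      by (rule degen_unique[OF Comp_in_Hom[OF f(1) \<phi>]])
        (simp_all add: Comp_assoc[OF \<iota>_Hom(1) f(1) \<phi>] Comp_assoc[OF \<iota>_Hom(2) f(1) \<phi>] f ab)
    then have y: "restr G f ?z = restr G (degen (\<phi> \<cdot> \<beta>)) x"
      using restr_Comp[OF f(1) \<phi> x] by simp
    have "perm b ?z \<alpha> = act G ?z f \<cdot> act G (restr G f ?z) \<iota>\<^sub>0"
      "perm b ?z \<beta> = act G ?z f \<cdot> act G (restr G f ?z) \<iota>\<^sub>1"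
      using act_Comp[OF \<iota>_Hom(1) f(1) z] act_Comp[OF \<iota>_Hom(2) f(1) z] f(2,3) ab(1,2) by (auto simp: perm_def)
    then show ?thesis using f(1) y restr_closed[OF f(1) z] by metis
  qed
  show ?thesis
  proof (rule twistsI[OF \<phi> act_closed[OF x \<phi>] perm_Bij[OF Hom_Obj(1)[OF \<phi>] z]])
    show "perm a x (\<phi> \<cdot> \<alpha>) = act G x \<phi> \<cdot> perm b ?z \<alpha>" if "\<alpha> \<in> P b" for \<alpha>
      using act_Comp[OF that \<phi> x] that comp_P[OF \<phi> that] by (simp add: perm_def)
  next
    fix \<alpha> \<beta> assume ab: "\<alpha> \<in> P b" "\<beta> \<in> P b" "\<phi> \<cdot> \<alpha> = \<phi> \<cdot> \<beta>" "lea b \<alpha> \<beta>"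
    obtain f y where f: "f \<in> Hom C sbar b" and y: "y = restr G (degen (\<phi> \<cdot> \<beta>)) x" "y \<in> carrier (grp G sbar)"
      and eq: "perm b ?z \<alpha> = act G ?z f \<cdot> act G y \<iota>\<^sub>0" "perm b ?z \<beta> = act G ?z f \<cdot> act G y \<iota>\<^sub>1"
      using fib[OF ab] by blast
    have sgn: "sign a x (\<phi> \<cdot> \<beta>) = 1 \<longleftrightarrow> lea sbar (act G y \<iota>\<^sub>0) (act G y \<iota>\<^sub>1)"
      using comp_P[OF \<phi> ab(2)] by (simp add: sign_def y(1) Let_def)
    note mono = comp_monotone[OF act_closed[OF z f]]
    show "lea b (perm b ?z \<alpha>) (perm b ?z \<beta>)" if "sign a x (\<phi> \<cdot> \<beta>) = 1"
      using that mono sgn eq by simp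
    show "lea b (perm b ?z \<beta>) (perm b ?z \<alpha>)" if "sign a x (\<phi> \<cdot> \<beta>) \<noteq> 1"
      using that mono sgn eq le_total[OF act_closed[OF y(2) \<iota>_Hom(1)] act_closed[OF y(2) \<iota>_Hom(2)]] by simp
  qed
qed

lemma perm_syms: "\<lbrakk>a \<in> Obj C; x \<in> carrier (grp G a)\<rbrakk> \<Longrightarrow> perm a x \<in> syms a"
  using twistsD(2-4)[OF act_twists] by (intro sym_permsI perm_Bij) blast+

lemma sym_act_perm: "\<lbrakk>\<phi> \<in> Hom C b a; x \<in> carrier (grp G a)\<rbrakk> \<Longrightarrow> sact (perm a x) \<phi> = act G x \<phi>"
  using sym_act_eq[OF perm_Bij act_twists] Hom_Obj by blast

lemma weyl_perm_perm:
  "\<lbrakk>\<phi> \<in> Hom C b a; x \<in> carrier (grp G a)\<rbrakk> \<Longrightarrow> wperm \<phi> (perm a x, sign a x) = perm b (restr G \<phi> x)"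
  using weyl_perm_eq[OF perm_syms sign_mem act_twists] Hom_Obj by blast

text \<open>The permutation over \<open>\<phi>\<close> comes from the restricted element of
  \<open>G\<close>, so it lies in \<open>syms\<close> for the same reason as
  \<open>perm a x\<close>.\<close>

lemma perm_sign_weyl: "\<lbrakk>a \<in> Obj C; x \<in> carrier (grp G a)\<rbrakk> \<Longrightarrow> (perm a x, sign a x) \<in> Wel a"
  using act_twists perm_syms restr_closed Hom_Obj
  by (intro weyl_elementsI sign_mem) blast+

lemma perm_mult:
  assumes "a \<in> Obj C" "x \<in> carrier (grp G a)" "y \<in> carrier (grp G a)"
  shows "perm a (x \<otimes>\<^bsub>grp G a\<^esub> y) = compose (P a) (perm a x) (perm a y)"
  unfolding compose_def perm_def
  by (rule restrict_ext) (simp add: act_mult[OF assms(2,3)] act_closed[OF assms(3)])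

text \<open>Axiom (ii) factors the permutation of the product over \<open>degen i\<close>, and
  vertical pasting attaches the product of signs to that same factorisation.\<close>

lemma sign_mult:
  assumes a: "a \<in> Obj C" and x: "x \<in> carrier (grp G a)" and y: "y \<in> carrier (grp G a)"
  shows "sign a (x \<otimes>\<^bsub>grp G a\<^esub> y) = (\<lambda>i\<in>P a. sign a x (perm a y i) * sign a y i)"
proof (rule extensionalityI[of _ "P a"])
  fix i assume i: "i \<in> P a"
  note d = degen(1)[OF i]
  have xy: "x \<otimes>\<^bsub>grp G a\<^esub> y \<in> carrier (grp G a)"
    using a x y grp by (simp add: group.is_monoid monoid.m_closed)
  let ?z = "restr G (degen i) (x \<otimes>\<^bsub>grp G a\<^esub> y)"
  let ?x = "restr G (act G y (degen i)) x" and ?y = "restr G (degen i) y"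
  have tw: "twists (degen i) (act G x (act G y (degen i))) (compose (P a) (perm a x) (perm a y))
    (\<lambda>i\<in>P a. sign a x (perm a y i) * sign a y i) (compose (P sbar) (perm sbar ?x) (perm sbar ?y)) sbar a"
    by (rule twists_vertical[OF act_twists[OF y d] act_twists[OF x act_closed[OF y d]]
          PiE_image[OF sign_mem] PiE_image[OF sign_mem]])
  have z: "perm sbar ?z = compose (P sbar) (perm sbar ?x) (perm sbar ?y)"
    unfolding restr_mult[OF d x y]
    by (rule perm_mult[OF sbar_Obj restr_closed[OF act_closed[OF y d] x] restr_closed[OF d y]])
  have "sign a (x \<otimes>\<^bsub>grp G a\<^esub> y) i = 1 \<longleftrightarrow> (\<lambda>i\<in>P a. sign a x (perm a y i) * sign a y i) i = 1"
    unfolding sign_eq_1_iff[OF i tw] sign_eq_1_iff[OF i act_twists[OF xy d]] z ..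
  moreover have "sign a (x \<otimes>\<^bsub>grp G a\<^esub> y) i \<in> {1, -1}" "sign a x (perm a y i) \<in> {1, -1}" "sign a y i \<in> {1, -1}"
    using PiE_mem[OF sign_mem i] PiE_mem[OF sign_mem Bij_apply[OF perm_Bij[OF a y] i]] by auto
  ultimately show "sign a (x \<otimes>\<^bsub>grp G a\<^esub> y) i = (\<lambda>i\<in>P a. sign a x (perm a y i) * sign a y i) i"
    using i by auto
next
  show "sign a (x \<otimes>\<^bsub>grp G a\<^esub> y) \<in> extensional (P a)" using sign_mem by (simp add: PiE_def)
qed simp

lemma sign_restr:
  assumes \<phi>: "\<phi> \<in> Hom C b a" and x: "x \<in> carrier (grp G a)"
  shows "sign b (restr G \<phi> x) = (\<lambda>j\<in>P b. sign a x (\<phi> \<cdot> j))"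
  unfolding sign_def
proof (rule restrict_ext)
  fix j assume j: "j \<in> P b"
  have "restr G (degen j) (restr G \<phi> x) = restr G (degen (\<phi> \<cdot> j)) x"
    using restr_Comp[OF degen(1)[OF j] \<phi> x] degen_comp[OF \<phi> j] by simp
  then show "(let y = restr G (degen j) (restr G \<phi> x) in
      if lea sbar (act G y \<iota>\<^sub>0) (act G y \<iota>\<^sub>1) then 1 else - 1) =
    (\<lambda>i\<in>P a. let y = restr G (degen i) x in
      if lea sbar (act G y \<iota>\<^sub>0) (act G y \<iota>\<^sub>1) then 1 else - (1::int)) (\<phi> \<cdot> j)"
    using comp_P[OF \<phi> j] by simp
qed

section \<open>Existence and uniqueness of the map to the Weyl crossed group\<close>

definition to_weyl :: "'o \<Rightarrow> 'g \<Rightarrow> ('m \<Rightarrow> 'm) \<times> ('m \<Rightarrow> int)" where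
  "to_weyl = (\<lambda>a\<in>Obj C. \<lambda>x\<in>carrier (grp G a). (perm a x, sign a x))"

lemma to_weyl_map: "to_weyl \<in> crossed_group_maps C G W"
  unfolding crossed_group_maps_def
proof (intro CollectI conjI ballI)
  have "restrict (\<lambda>x. (perm a x, sign a x)) (carrier (grp G a)) \<in> hom (grp G a) (grp W a)"
    if a: "a \<in> Obj C" for a
  proof (rule homI; unfold weyl_simps)
    show "restrict (\<lambda>x. (perm a x, sign a x)) (carrier (grp G a)) x \<in> Wel a"
      if "x \<in> carrier (grp G a)" for x
      using perm_sign_weyl[OF a that] that by simp
    fix x y assume xy: "x \<in> carrier (grp G a)" "y \<in> carrier (grp G a)"
    then have "x \<otimes>\<^bsub>grp G a\<^esub> y \<in> carrier (grp G a)"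
      using a grp by (simp add: group.is_monoid monoid.m_closed)
    with xy show "restrict (\<lambda>x. (perm a x, sign a x)) (carrier (grp G a)) (x \<otimes>\<^bsub>grp G a\<^esub> y) =
      wmult a (restrict (\<lambda>x. (perm a x, sign a x)) (carrier (grp G a)) x)
        (restrict (\<lambda>x. (perm a x, sign a x)) (carrier (grp G a)) y)"
      by (simp add: wmult_def perm_mult[OF a xy] sign_mult[OF a xy])
  qed
  then show "to_weyl \<in> (\<Pi>\<^sub>E a\<in>Obj C. hom (grp G a) (grp W a) \<inter> extensional (carrier (grp G a)))"
    by (simp add: to_weyl_def)
  fix a b \<phi> x assume ab: "a \<in> Obj C" "b \<in> Obj C" and \<phi>: "\<phi> \<in> Hom C a b" and x: "x \<in> carrier (grp G b)"
  show "to_weyl a (restr G \<phi> x) = restr W \<phi> (to_weyl b x)"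
    using ab x restr_closed[OF \<phi> x]
    by (simp add: to_weyl_def weyl_simps weyl_perm_perm[OF \<phi> x] pull_signs_eq[OF \<phi>] sign_restr[OF \<phi> x])
  show "act W (to_weyl b x) \<phi> = act G x \<phi>"
    using ab x by (simp add: to_weyl_def weyl_simps sym_act_perm[OF \<phi> x])
qed

text \<open>Compatibility with the actions on arrows out of \<open>s\<close> fixes the permutation
  through \<open>sym_act_generator\<close>; naturality along degenerate arrows then fixes the
  signs.\<close>

lemma map_to_weyl_unique:
  assumes \<theta>: "\<theta> \<in> crossed_group_maps C G W"
  shows "\<theta> = to_weyl"
proof -
  have ext: "\<theta> \<in> extensional (Obj C)"
    and hom: "\<And>a. a \<in> Obj C \<Longrightarrow> \<theta> a \<in> hom (grp G a) (grp W a)"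
    and ext': "\<And>a. a \<in> Obj C \<Longrightarrow> \<theta> a \<in> extensional (carrier (grp G a))"
    using \<theta> by (auto simp: crossed_group_maps_def PiE_def)
  have nat: "\<theta> b (restr G \<phi> x) = restr W \<phi> (\<theta> a x)" "sact (fst (\<theta> a x)) \<phi> = act G x \<phi>"
    if "\<phi> \<in> Hom C b a" "x \<in> carrier (grp G a)" for \<phi> a b x
    using \<theta> that Hom_Obj[OF that(1)] by (auto simp: crossed_group_maps_def weyl_simps)
  have mem: "(fst (\<theta> a x), snd (\<theta> a x)) \<in> Wel a" if "a \<in> Obj C" "x \<in> carrier (grp G a)" for a x
    using hom_in_carrier[OF hom that(2)] that(1) by (simp add: weyl_simps)
  have perm: "fst (\<theta> a x) = perm a x" if "a \<in> Obj C" "x \<in> carrier (grp G a)" for a x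
  proof (rule Bij_eqI[OF weyl_elementsD(2)[OF mem[OF that]] perm_Bij[OF that]])
    fix i assume "i \<in> P a"
    with nat(2)[OF this that(2)] sym_act_generator[OF weyl_elementsD(1)[OF mem[OF that]] this]
    show "fst (\<theta> a x) i = perm a x i" by (simp add: perm_def)
  qed
  have sign: "snd (\<theta> a x) = sign a x" if a: "a \<in> Obj C" and x: "x \<in> carrier (grp G a)" for a x
  proof (rule extensionalityI[of _ "P a"])
    fix i assume i: "i \<in> P a"
    note d = degen(1)[OF i] and W = weyl_elementsD[OF mem[OF a x]]
    \<comment> \<open>Naturality expresses the permutation over \<open>degen i\<close> by the
      already determined permutation at \<open>sbar\<close>, so both sign functions are read from
      the same data.\<close>
    have "wperm (degen i) (fst (\<theta> a x), snd (\<theta> a x)) = perm sbar (restr G (degen i) x)"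
      using nat(1)[OF d x] perm[OF sbar_Obj restr_closed[OF d x]] by (simp add: weyl_simps)
    then have "snd (\<theta> a x) i = 1 \<longleftrightarrow> sign a x i = 1"
      using sign_eq_1_iff[OF i W(4)[OF d]] sign_eq_1_iff[OF i act_twists[OF x d]] by simp
    moreover have "snd (\<theta> a x) i \<in> {1, -1}" "sign a x i \<in> {1, -1}"
      using PiE_mem[OF W(3) i] PiE_mem[OF sign_mem i] .
    ultimately show "snd (\<theta> a x) i = sign a x i" by auto
  next
    show "snd (\<theta> a x) \<in> extensional (P a)" "sign a x \<in> extensional (P a)"
      using weyl_elementsD(3)[OF mem[OF a x]] sign_mem by (simp_all add: PiE_def)
  qed
  show ?thesis
  proof (rule extensionalityI[OF ext])
    fix a assume a: "a \<in> Obj C"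
    show "\<theta> a = to_weyl a"
    proof (rule extensionalityI[OF ext'[OF a]])
      fix x assume "x \<in> carrier (grp G a)"
      with perm[OF a this] sign[OF a this] a show "\<theta> a x = to_weyl a x"
        by (simp add: to_weyl_def prod_eq_iff)
    qed (simp add: to_weyl_def a)
  qed (simp add: to_weyl_def)
qed

end

theorem theorem3p13:
  fixes C :: "('o, 'm) category"
    and s sbar :: 'o and \<iota>\<^sub>0 \<iota>\<^sub>1 :: 'm
  assumes "small_category C"
    and "locally_finite C"
    and "generator C s"
    and "well_co_order C s sbar \<iota>\<^sub>0 \<iota>\<^sub>1"
    and "\<iota>\<^sub>0 \<noteq> \<iota>\<^sub>1"
  shows "crossed_group C (weyl C s sbar \<iota>\<^sub>0 \<iota>\<^sub>1) \<and>
    (\<forall>G :: ('o, 'm, 'g) crossed_group_data. crossed_group C G \<longrightarrow>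
       (\<exists>!\<theta>. \<theta> \<in> crossed_group_maps C G (weyl C s sbar \<iota>\<^sub>0 \<iota>\<^sub>1)))"
proof -
  interpret small_category C by fact
  interpret co_ordered_category C s sbar \<iota>\<^sub>0 \<iota>\<^sub>1
    by unfold_locales fact+
  have "\<exists>!\<theta>. \<theta> \<in> crossed_group_maps C G W" if "crossed_group C G"
    for G :: "('o, 'm, 'g) crossed_group_data"
  proof -
    interpret crossed_group C G by fact
    interpret co_ordered_crossed_group C s sbar \<iota>\<^sub>0 \<iota>\<^sub>1 G ..
    show ?thesis using to_weyl_map map_to_weyl_unique by blast
  qed
  with weyl_crossed_group show ?thesis by blast
qed

end
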